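(* Let $n\ge1$, let $F=(f_1,\dots,f_n):\mathbb{R}^n\to\mathbb{R}^n$ be locally Lipschitz continuous, and let $(\alpha_1,\dots,\alpha_n)$, $(\beta_1,\dots,\beta_n)$ be real numbers with $\alpha_j<\beta_j$ for all $j\in\{1,\dots,n\}$. Put $R=\prod_{1\le j\le n}[\alpha_j,\beta_j]$. Consider the two conditions $$(R_{\inf})\qquad \forall i\in\{1,\dots,n\},\ \forall (u_j)_{j\neq i}\in\prod_{j\neq i}[\alpha_j,\beta_j],\quad f_i(u_1,\dots,u_{i-1},\alpha_i,u_{i+1},\dots,u_n)\ge0,$$ $$(R_{\sup})\qquad \forall i\in\{1,\dots,n\},\ \forall (u_j)_{j\neq i}\in\prod_{j\neq i}[\alpha_j,\beta_j],\quad f_i(u_1,\dots,u_{i-1},\beta_i,u_{i+1},\dots,u_n)\le0 .$$ (a) The region $R$ is invariant under the (local) semi-flow generated by the system $\dot U=F(U)$ if and only if $(R_{\inf})$ and $(R_{\sup})$ are both satisfied. (b) Let $\Omega\subset\mathbb{R}^d$ ($d\ge1$) be a bounded domain with $C^1$ boundary and let $d_1,\dots,d_n>0$. The set $$\mathcal{R}=\{U\in C(\overline\Omega,\mathbb{R}^n):\ \forall x\in\overline\Omega,\ U(x)\in R\}$$ is invariant under the local semi-flow generated by the parabolic system with homogeneous Neumann boundary conditions $$\frac{\partial u_i}{\partial t}-d_i\Delta u_i=f_i(u_1,\dots,u_n)\ \text{ in }\mathbb{R}^+\times\Omega,\qquad \frac{\partial u_i}{\partial\nu}=0\ \text{ on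 }\mathbb{R}^+\times\partial\Omega,\qquad i=1,\dots,n,$$ if and only if $(R_{\inf})$ and $(R_{\sup})$ are both satisfied.
   Context: A set is invariant under a local semi-flow if every maximal forward trajectory, defined on $[0,T_{\max})$ with $0<T_{\max}\le\infty$, whose initial value lies in the set remains in the set for all $t\in[0,T_{\max})$. "Domain" means nonempty connected open set. For the parabolic system, trajectories are maximal mild solutions: $U=(u_1,\dots,u_n)\in C([0,T_{\max}),C(\overline\Omega)^n)$ with $$u_i(t)=S_i(t)u_i(0)+\int_0^tS_i(t-s)f_i(u_1(s),\dots,u_n(s))\,ds,\qquad t\in[0,T_{\max}),\ i=1,\dots,n,$$ where $S_i(t)$ is the contraction semigroup on $C(\overline\Omega)$ (real-valued, sup norm) generated by $d_i\Delta$ with homogeneous Neumann boundary conditions and its standard domain (the restriction to $C(\overline\Omega)$ of the $L^2(\Omega)$-semigroup generated by $d_i$ times the Neumann Laplacian, the latter being associated with the form $\int_\Omega\nabla u\cdot\nabla v\,dx$ on $H^1(\Omega)$). *)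

theory Defs
  imports "HOL-Analysis.Analysis"
begin

section \<open>Trajectories of local semi-flows and invariant sets\<close>

definition forward_interval :: "ereal \<Rightarrow> real set" where
  "forward_interval T = {t. 0 \<le> t \<and> ereal t < T}"

text \<open>
  \<open>sol T u\<close> says that \<open>u\<close> solves the equation on \<open>[0, T)\<close>. The relation \<open>eq\<close> is equality of
  states; it differs from HOL equality when states are functions on a set \<open>K\<close>, represented by
  total functions whose values outside \<open>K\<close> are irrelevant.
\<close>

definition maximal_trajectory ::
    "('s \<Rightarrow> 's \<Rightarrow> bool) \<Rightarrow> (ereal \<Rightarrow> (real \<Rightarrow> 's) \<Rightarrow> bool) \<Rightarrow> ereal \<Rightarrow> (real \<Rightarrow> 's) \<Rightarrow> bool" where
  "maximal_trajectory eq sol T u \<longleftrightarrow>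
     0 < T \<and> sol T u \<and>
     \<not> (\<exists>T' v. T < T' \<and> sol T' v \<and> (\<forall>t\<in>forward_interval T. eq (v t) (u t)))"

definition invariant_under ::
    "('s \<Rightarrow> 's \<Rightarrow> bool) \<Rightarrow> (ereal \<Rightarrow> (real \<Rightarrow> 's) \<Rightarrow> bool) \<Rightarrow> 's set \<Rightarrow> bool" where
  "invariant_under eq sol M \<longleftrightarrow>
     (\<forall>T u. maximal_trajectory eq sol T u \<longrightarrow> u 0 \<in> M \<longrightarrow> (\<forall>t\<in>forward_interval T. u t \<in> M))"

definition ode_solution ::
    "('s::real_normed_vector \<Rightarrow> 's) \<Rightarrow> ereal \<Rightarrow> (real \<Rightarrow> 's) \<Rightarrow> bool" where
  "ode_solution F T u \<longleftrightarrow>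
     (\<forall>t\<in>forward_interval T. (u has_vector_derivative F (u t)) (at t within forward_interval T))"


section \<open>The conditions on the vector field\<close>

definition locally_lipschitz :: "('a::metric_space \<Rightarrow> 'b::metric_space) \<Rightarrow> bool" where
  "locally_lipschitz F \<longleftrightarrow> (\<forall>x. \<exists>r>0. \<exists>L. L-lipschitz_on (ball x r) F)"

definition R_inf :: "(real^'n \<Rightarrow> real^'n) \<Rightarrow> real^'n \<Rightarrow> real^'n \<Rightarrow> bool" where
  "R_inf F \<alpha> \<beta> \<longleftrightarrow>
     (\<forall>i u. (\<forall>j. j \<noteq> i \<longrightarrow> u $ j \<in> {\<alpha> $ j..\<beta> $ j}) \<longrightarrow>
        F (\<chi> j. if j = i then \<alpha> $ i else u $ j) $ i \<ge> 0)"

definition R_sup :: "(real^'n \<Rightarrow> real^'n) \<Rightarrow> real^'n \<Rightarrow> real^'n \<Rightarrow> bool" where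
  "R_sup F \<alpha> \<beta> \<longleftrightarrow>
     (\<forall>i u. (\<forall>j. j \<noteq> i \<longrightarrow> u $ j \<in> {\<alpha> $ j..\<beta> $ j}) \<longrightarrow>
        F (\<chi> j. if j = i then \<beta> $ i else u $ j) $ i \<le> 0)"


section \<open>Functions of class \<open>C\<^sup>k\<close>, and \<open>C\<^sup>1\<close> boundaries\<close>

primrec class_C :: "nat \<Rightarrow> ('a::euclidean_space \<Rightarrow> real) \<Rightarrow> bool" where
  "class_C 0 f \<longleftrightarrow> continuous_on UNIV f"
| "class_C (Suc k) f \<longleftrightarrow>
     (\<forall>x. f differentiable at x) \<and> (\<forall>b\<in>Basis. class_C k (\<lambda>x. frechet_derivative f (at x) b))"

text \<open>
  Near each boundary point, \<open>\<Omega>\<close> is the part of a ball strictly above the graph of a \<open>C\<^sup>1\<close>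
  function, with respect to some ``vertical'' unit direction \<open>\<nu>\<close>. The function \<open>\<gamma>\<close> is only
  evaluated on the hyperplane orthogonal to \<open>\<nu>\<close>; a \<open>C\<^sup>1\<close> function on the hyperplane extends to
  the whole space, constantly in direction \<open>\<nu>\<close>.
\<close>

definition C1_boundary :: "'a::euclidean_space set \<Rightarrow> bool" where
  "C1_boundary \<Omega> \<longleftrightarrow>
     (\<forall>p\<in>frontier \<Omega>. \<exists>r>0. \<exists>\<nu> \<gamma>. norm \<nu> = 1 \<and> class_C 1 \<gamma> \<and>
        \<Omega> \<inter> ball p r = {x \<in> ball p r. x \<bullet> \<nu> > \<gamma> (x - (x \<bullet> \<nu>) *\<^sub>R \<nu>)})"


section \<open>The Neumann Laplacian on \<open>L\<^sup>2(\<Omega>)\<close>\<close>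

text \<open>
  Elements of \<open>L\<^sup>2(\<Omega>)\<close> are represented by square integrable functions, without passing to the
  quotient; equality in \<open>L\<^sup>2(\<Omega>)\<close> is equality almost everywhere in \<open>\<Omega>\<close>.
\<close>

definition L2 :: "'a::euclidean_space set \<Rightarrow> ('a \<Rightarrow> real) set" where
  "L2 \<Omega> = {u \<in> borel_measurable (lebesgue_on \<Omega>). integrable (lebesgue_on \<Omega>) (\<lambda>x. (u x)\<^sup>2)}"

definition L2_norm_on :: "'a::euclidean_space set \<Rightarrow> ('a \<Rightarrow> real) \<Rightarrow> real" where
  "L2_norm_on \<Omega> u = sqrt (LINT x|lebesgue_on \<Omega>. (u x)\<^sup>2)"

definition test_function :: "'a::euclidean_space set \<Rightarrow> ('a \<Rightarrow> real) \<Rightarrow> bool" where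
  "test_function \<Omega> \<phi> \<longleftrightarrow>
     (\<forall>k. class_C k \<phi>) \<and> compact (closure {x. \<phi> x \<noteq> 0}) \<and> closure {x. \<phi> x \<noteq> 0} \<subseteq> \<Omega>"

text \<open>\<open>H1_gradient \<Omega> u g\<close>: \<open>u \<in> H\<^sup>1(\<Omega>)\<close> with weak gradient \<open>g\<close>.\<close>

definition H1_gradient :: "'a::euclidean_space set \<Rightarrow> ('a \<Rightarrow> real) \<Rightarrow> ('a \<Rightarrow> 'a) \<Rightarrow> bool" where
  "H1_gradient \<Omega> u g \<longleftrightarrow>
     u \<in> L2 \<Omega> \<and>
     (\<forall>b\<in>Basis. (\<lambda>x. g x \<bullet> b) \<in> L2 \<Omega> \<and>
        (\<forall>\<phi>. test_function \<Omega> \<phi> \<longrightarrow>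
           (LINT x|lebesgue_on \<Omega>. u x * frechet_derivative \<phi> (at x) b)
             = - (LINT x|lebesgue_on \<Omega>. (g x \<bullet> b) * \<phi> x)))"

text \<open>
  \<open>neumann_laplacian \<Omega> u f\<close>: \<open>u\<close> lies in the domain of the Neumann Laplacian of \<open>L\<^sup>2(\<Omega>)\<close> and is
  mapped to \<open>f\<close>. The form \<open>\<integral>\<nabla>u \<cdot> \<nabla>v\<close> represents \<open>-\<Delta>\<close>, hence the sign.
\<close>

definition neumann_laplacian :: "'a::euclidean_space set \<Rightarrow> ('a \<Rightarrow> real) \<Rightarrow> ('a \<Rightarrow> real) \<Rightarrow> bool" where
  "neumann_laplacian \<Omega> u f \<longleftrightarrow>
     f \<in> L2 \<Omega> \<and>
     (\<exists>g. H1_gradient \<Omega> u g \<and>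
        (\<forall>v h. H1_gradient \<Omega> v h \<longrightarrow>
           (LINT x|lebesgue_on \<Omega>. g x \<bullet> h x) = - (LINT x|lebesgue_on \<Omega>. f x * v x)))"


section \<open>The Neumann heat semigroup on \<open>L\<^sup>2(\<Omega>)\<close> and on \<open>C(closure \<Omega>)\<close>\<close>

definition C0_semigroup_L2 ::
    "'a::euclidean_space set \<Rightarrow> (real \<Rightarrow> ('a \<Rightarrow> real) \<Rightarrow> 'a \<Rightarrow> real) \<Rightarrow> bool" where
  "C0_semigroup_L2 \<Omega> T \<longleftrightarrow>
     (\<forall>t\<ge>0. \<forall>u\<in>L2 \<Omega>. T t u \<in> L2 \<Omega>) \<and>
     (\<forall>t\<ge>0. \<forall>u\<in>L2 \<Omega>. \<forall>v\<in>L2 \<Omega>. \<forall>a b.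
        AE x in lebesgue_on \<Omega>. T t (\<lambda>y. a * u y + b * v y) x = a * T t u x + b * T t v x) \<and>
     (\<forall>t\<ge>0. \<exists>C. \<forall>u\<in>L2 \<Omega>. L2_norm_on \<Omega> (T t u) \<le> C * L2_norm_on \<Omega> u) \<and>
     (\<forall>u\<in>L2 \<Omega>. AE x in lebesgue_on \<Omega>. T 0 u x = u x) \<and>
     (\<forall>s\<ge>0. \<forall>t\<ge>0. \<forall>u\<in>L2 \<Omega>. AE x in lebesgue_on \<Omega>. T (s + t) u x = T s (T t u) x) \<and>
     (\<forall>u\<in>L2 \<Omega>. ((\<lambda>t. L2_norm_on \<Omega> (\<lambda>x. T t u x - u x)) \<longlongrightarrow> 0) (at_right 0))"

text \<open>\<open>generator_L2 \<Omega> T u f\<close>: \<open>u\<close> lies in the domain of the generator of \<open>T\<close> and is mapped to \<open>f\<close>.\<close>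

definition generator_L2 ::
    "'a::euclidean_space set \<Rightarrow> (real \<Rightarrow> ('a \<Rightarrow> real) \<Rightarrow> 'a \<Rightarrow> real) \<Rightarrow>
     ('a \<Rightarrow> real) \<Rightarrow> ('a \<Rightarrow> real) \<Rightarrow> bool" where
  "generator_L2 \<Omega> T u f \<longleftrightarrow>
     u \<in> L2 \<Omega> \<and> f \<in> L2 \<Omega> \<and>
     ((\<lambda>t. L2_norm_on \<Omega> (\<lambda>x. (T t u x - u x) / t - f x)) \<longlongrightarrow> 0) (at_right 0)"

definition neumann_semigroup_L2 ::
    "'a::euclidean_space set \<Rightarrow> real \<Rightarrow> (real \<Rightarrow> ('a \<Rightarrow> real) \<Rightarrow> 'a \<Rightarrow> real) \<Rightarrow> bool" where
  "neumann_semigroup_L2 \<Omega> d T \<longleftrightarrow>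
     C0_semigroup_L2 \<Omega> T \<and>
     (\<forall>u f. generator_L2 \<Omega> T u f \<longleftrightarrow> (\<exists>w. neumann_laplacian \<Omega> u w \<and> f \<in> L2 \<Omega> \<and>
        (AE x in lebesgue_on \<Omega>. f x = d * w x)))"

text \<open>
  Elements of \<open>C(K)\<close> are represented by total functions that are continuous on \<open>K\<close>, with
  equality on \<open>K\<close>; convergence in \<open>C(K)\<close> is uniform convergence on \<open>K\<close>.
\<close>

definition contraction_semigroup_C ::
    "'a::euclidean_space set \<Rightarrow> (real \<Rightarrow> ('a \<Rightarrow> real) \<Rightarrow> 'a \<Rightarrow> real) \<Rightarrow> bool" where
  "contraction_semigroup_C K S \<longleftrightarrow>
     (\<forall>t\<ge>0. \<forall>u. continuous_on K u \<longrightarrow> continuous_on K (S t u)) \<and>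
     (\<forall>t\<ge>0. \<forall>u v a b. continuous_on K u \<longrightarrow> continuous_on K v \<longrightarrow>
        (\<forall>x\<in>K. S t (\<lambda>y. a * u y + b * v y) x = a * S t u x + b * S t v x)) \<and>
     (\<forall>t\<ge>0. \<forall>u. continuous_on K u \<longrightarrow> (SUP x\<in>K. \<bar>S t u x\<bar>) \<le> (SUP x\<in>K. \<bar>u x\<bar>)) \<and>
     (\<forall>u. continuous_on K u \<longrightarrow> (\<forall>x\<in>K. S 0 u x = u x)) \<and>
     (\<forall>s\<ge>0. \<forall>t\<ge>0. \<forall>u. continuous_on K u \<longrightarrow> (\<forall>x\<in>K. S (s + t) u x = S s (S t u) x)) \<and>
     (\<forall>u. continuous_on K u \<longrightarrow> uniform_limit K (\<lambda>t. S t u) u (at_right 0))"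

text \<open>
  \<open>S\<close> is the contraction semigroup on \<open>C(closure \<Omega>)\<close> generated by \<open>d\<Delta>\<close> with homogeneous Neumann
  boundary conditions, that is, the restriction of the semigroup on \<open>L\<^sup>2(\<Omega>)\<close>. Up to values
  outside \<open>closure \<Omega>\<close> and at negative times, these properties determine \<open>S\<close>.
\<close>

definition neumann_semigroup_C ::
    "'a::euclidean_space set \<Rightarrow> real \<Rightarrow> (real \<Rightarrow> ('a \<Rightarrow> real) \<Rightarrow> 'a \<Rightarrow> real) \<Rightarrow> bool" where
  "neumann_semigroup_C \<Omega> d S \<longleftrightarrow>
     contraction_semigroup_C (closure \<Omega>) S \<and>
     (\<exists>T. neumann_semigroup_L2 \<Omega> d T \<and>
        (\<forall>t\<ge>0. \<forall>u. continuous_on (closure \<Omega>) u \<longrightarrow>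
           (AE x in lebesgue_on \<Omega>. S t u x = T t u x)))"


section \<open>Mild solutions of the parabolic system\<close>

text \<open>
  The variation of constants formula is evaluated at the points of \<open>K = closure \<Omega>\<close>. As point
  evaluations are continuous on \<open>C(K)\<close> and separate points, this is the same as the identity
  between the \<open>C(K)\<close>-valued integrals; the integrands are continuous in \<open>s\<close>, so the integrals exist.
\<close>

definition mild_solution ::
    "'a::euclidean_space set \<Rightarrow> ('n::finite \<Rightarrow> real \<Rightarrow> ('a \<Rightarrow> real) \<Rightarrow> 'a \<Rightarrow> real) \<Rightarrow>
     (real^'n \<Rightarrow> real^'n) \<Rightarrow> ereal \<Rightarrow> (real \<Rightarrow> 'a \<Rightarrow> real^'n) \<Rightarrow> bool" where
  "mild_solution K S F T U \<longleftrightarrow>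
     (\<forall>t\<in>forward_interval T. continuous_on K (U t)) \<and>
     (\<forall>t\<in>forward_interval T. uniform_limit K U (U t) (at t within forward_interval T)) \<and>
     (\<forall>t\<in>forward_interval T. \<forall>i. \<forall>x\<in>K.
        U t x $ i = S i t (\<lambda>y. U 0 y $ i) x
          + integral {0..t} (\<lambda>s. S i (t - s) (\<lambda>y. F (U s y) $ i) x))"

definition equal_on :: "'a set \<Rightarrow> ('a \<Rightarrow> 'b) \<Rightarrow> ('a \<Rightarrow> 'b) \<Rightarrow> bool" where
  "equal_on K u v \<longleftrightarrow> (\<forall>x\<in>K. u x = v x)"

end

theory Submission
  imports Defs
begin

text \<open>
  Both parts are instances of one statement about mild solutions on a compact space \<open>K\<close> driven by
  contraction semigroups \<open>S i\<close> on \<open>C(K)\<close> with \<open>S i t 1 = 1\<close>: an ordinary differential equation is the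
  case of a one-point \<open>K\<close>.

  For sufficiency, contractivity and \<open>S i t 1 = 1\<close> give \<open>S i t u \<le> k\<close> whenever \<open>u \<le> k\<close>. After adding
  \<open>L u\<close> to the field, \<open>L\<close> being a Lipschitz constant, the conditions on the faces say that the field
  points inward up to a multiple of the distance to the box, and a Gronwall argument with an
  exponential weight shows that this distance vanishes. For necessity, spatially constant solutions
  reduce the question to the ordinary differential equation, whose solutions leave the box at once
  if a condition fails on a face; Zorn's lemma extends them to maximal trajectories.

  That the Neumann semigroup fixes the constant 1 is read off from its generator, which maps 1 to 0.
\<close>

text \<open>The field has no global Lipschitz constant. For sufficiency a time \<open>t\<close>
  below \<open>T\<close> is therefore fixed: the values of the trajectory on
  \<open>{0..t} \<times> K\<close> together with the box form a compact set, and \<open>L\<close> is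
  a Lipschitz constant there. Why \<open>L u\<close> is added: let \<open>w\<close> be the
  projection of a state \<open>v\<close> to the box. Passing from \<open>w\<close> to the face
  \<open>w_i = \<beta>_i\<close> costs \<open>L * (\<beta>_i - w_i)\<close>, which is not small when
  the state is far from that face. The added term \<open>L * (v_i - \<beta>_i)\<close> cancels this
  cost up to \<open>L * (v_i - w_i)\<close>, a multiple of the distance to the box. For necessity,
  invariance speaks only of maximal trajectories, whereas a short solution of the ordinary
  differential equation is what is at hand. It suffices that some maximal trajectory agrees with it
  on its short interval. Continuity with values in C(K) is handled throughout as joint continuity on
  a product with \<open>K\<close>, and integrals of C(K)-valued maps as real integrals at a fixed
  point of \<open>K\<close>.\<close>

section \<open>Continuity in C(K) versus joint continuity\<close>

text \<open>Compactness of \<open>K\<close> gives a neighbourhood of \<open>t\<close> that serves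
  all \<open>x\<close> at once.\<close>

lemma joint_continuous_uniform_limit:
  fixes g :: "'t::topological_space \<Rightarrow> 'a::topological_space \<Rightarrow> 'b::metric_space"
  assumes "continuous_on (I \<times> K) (\<lambda>(t, x). g t x)" "compact K" "t \<in> I"
  shows "uniform_limit K g (g t) (at t within I)"
proof (rule uniform_limitI)
  fix e :: real assume "e > 0"
  then obtain X where X: "t \<in> X" "open X"
      "\<forall>s\<in>X \<inter> I. \<forall>x\<in>K. dist (g s x) (g t x) \<le> e / 2"
    by (rule_tac continuous_on_prod_compactE[OF assms, of "e / 2"]) (simp, simp add: that)
  have "\<forall>\<^sub>F s in at t within I. s \<in> X \<inter> I"
    using X(1,2) unfolding eventually_at_topological by blast
  then show "\<forall>\<^sub>F s in at t within I. \<forall>x\<in>K. dist (g s x) (g t x) < e"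
  proof eventually_elim
    case (elim s)
    show ?case
    proof
      fix x assume "x \<in> K"
      then have "dist (g s x) (g t x) \<le> e / 2" using X(3) elim by blast
      then show "dist (g s x) (g t x) < e" using \<open>e > 0\<close> by linarith
    qed
  qed
qed

text \<open>Converse passage: it packs the two continuity clauses of \<open>mild_solution\<close>
  into one statement to which the usual continuity rules apply.\<close>

lemma uniform_limit_joint_continuous:
  fixes g :: "real \<Rightarrow> 'a::metric_space \<Rightarrow> 'b::metric_space"
  assumes c: "\<And>t. t \<in> I \<Longrightarrow> continuous_on K (g t)"
    and l: "\<And>t. t \<in> I \<Longrightarrow> uniform_limit K g (g t) (at t within I)"
  shows "continuous_on (I \<times> K) (\<lambda>(t, x). g t x)"
  unfolding continuous_on_iff
proof (intro ballI allI impI)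
  fix q and e :: real assume "q \<in> I \<times> K" "e > 0"
  then obtain t x where [simp]: "q = (t, x)" and *: "t \<in> I" "x \<in> K" "e > 0" by auto
  then have "\<forall>\<^sub>F s in at t within I. \<forall>y\<in>K. dist (g s y) (g t y) < e / 2"
    using uniform_limitD[OF l, of t "e / 2"] by simp
  then obtain d1 where d1: "d1 > 0"
      "\<And>s y. s \<in> I \<Longrightarrow> s \<noteq> t \<Longrightarrow> dist s t < d1 \<Longrightarrow> y \<in> K \<Longrightarrow> dist (g s y) (g t y) < e / 2"
    unfolding eventually_at by metis
  obtain d2 where d2: "d2 > 0"
      "\<And>y. y \<in> K \<Longrightarrow> dist y x < d2 \<Longrightarrow> dist (g t y) (g t x) < e / 2"
    using c[OF *(1)] * unfolding continuous_on_iff by (metis half_gt_zero)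
  show "\<exists>d>0. \<forall>p\<in>I \<times> K. dist p q < d \<longrightarrow>
      dist (case p of (t, x) \<Rightarrow> g t x) (case q of (t, x) \<Rightarrow> g t x) < e"
  proof (intro exI[of _ "min d1 d2"] conjI ballI impI)
    fix p assume p: "p \<in> I \<times> K" "dist p q < min d1 d2"
    obtain s y where [simp]: "p = (s, y)" by fastforce
    have "dist s t < d1" "dist y x < d2"
      using p dist_fst_le[of p "(t, x)"] dist_snd_le[of p "(t, x)"] by auto
    moreover have "s \<in> I" "y \<in> K" using p by auto
    \<comment> \<open>The filter \<open>at t within I\<close> says nothing about
      \<open>s = t\<close>, where the first distance is 0.\<close>
    ultimately have "dist (g s y) (g t y) < e / 2" "dist (g t y) (g t x) < e / 2"
      using d1(2)[of s y] d2(2)[of y] \<open>e > 0\<close> by (cases "s = t"; simp)+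
    then show "dist (case p of (t, x) \<Rightarrow> g t x) (case q of (t, x) \<Rightarrow> g t x) < e"
      using dist_triangle[of "g s y" "g t x" "g t y"] by simp
  qed (use d1 d2 in auto)
qed

text \<open>Mean value inequality for the indefinite integral minus \<open>s * f a\<close>, whose
  derivative is \<open>f s - f a\<close>. The explicit error \<open>e * \<bar>b - a\<bar>\<close> is
  what can be made uniform in a parameter; \<open>b\<close> may lie on either side of
  \<open>a\<close>.\<close>

lemma indefinite_integral_linear_approx:
  fixes f :: "real \<Rightarrow> real"
  assumes f: "continuous_on {0..r} f" and ab: "a \<in> {0..r}" "b \<in> {0..r}"
    and e: "\<And>s. s \<in> closed_segment a b \<Longrightarrow> \<bar>f s - f a\<bar> \<le> e"
  shows "\<bar>integral {0..b} f - integral {0..a} f - (b - a) * f a\<bar> \<le> e * \<bar>b - a\<bar>"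
proof -
  have sub: "closed_segment a b \<subseteq> {0..r}"
    using ab by (metis atLeastAtMost_iff closed_segment_subset convex_real_interval(5))
  have d: "((\<lambda>s. integral {0..s} f - s * f a) has_derivative (\<lambda>h. h * (f s - f a)))
      (at s within closed_segment a b)" if "s \<in> closed_segment a b" for s
  proof -
    have "((\<lambda>s. integral {0..s} f) has_vector_derivative f s) (at s within {0..r})"
      using integral_has_vector_derivative[OF f] that sub by blast
    then have "((\<lambda>s. integral {0..s} f) has_vector_derivative f s) (at s within closed_segment a b)"
      using has_vector_derivative_within_subset sub by blast
    then have "((\<lambda>s. integral {0..s} f) has_derivative (\<lambda>h. h * f s)) (at s within closed_segment a b)"
      by (simp add: has_vector_derivative_def)
    then show ?thesis
      by (auto intro!: derivative_eq_intros simp: algebra_simps)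
  qed
  have "norm ((integral {0..b} f - b * f a) - (integral {0..a} f - a * f a)) \<le> e * norm (b - a)"
  proof (rule differentiable_bound[OF convex_closed_segment d])
    fix s assume "s \<in> closed_segment a b"
    then have "norm (h * (f s - f a)) \<le> e * norm h" for h
      using mult_left_mono[OF e, of s "\<bar>h\<bar>"] by (simp add: abs_mult mult.commute)
    then show "onorm (\<lambda>h. h * (f s - f a)) \<le> e"
      by (intro onorm_le) (auto simp: mult.commute)
  qed auto
  then show ?thesis by (simp add: algebra_simps)
qed

lemma
  fixes g :: "'t::topological_space \<Rightarrow> 'a::topological_space \<Rightarrow> 'b::topological_space"
  assumes "continuous_on (I \<times> K) (\<lambda>(t, x). g t x)"
  shows continuous_on_slice1: "s \<in> I \<Longrightarrow> continuous_on K (g s)"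
    and continuous_on_slice2: "y \<in> K \<Longrightarrow> continuous_on I (\<lambda>t. g t y)"
proof -
  show "continuous_on K (g s)" if "s \<in> I"
    using continuous_on_compose2[OF assms, of K "Pair s"] that
    by (auto simp: image_subset_iff continuous_on_Pair)
  show "continuous_on I (\<lambda>t. g t y)" if "y \<in> K"
    using continuous_on_compose2[OF assms, of I "\<lambda>t. (t, y)"] that
    by (auto simp: image_subset_iff continuous_on_Pair)
qed

section \<open>Markov semigroups on C(K)\<close>

text \<open>\<open>S_one\<close> says that constants are preserved. Together with contractivity it
  yields order bounds, and hence positivity, in \<open>S_upper\<close>.\<close>

locale markov_semigroup =
  fixes K :: "'a::euclidean_space set" and S :: "real \<Rightarrow> ('a \<Rightarrow> real) \<Rightarrow> 'a \<Rightarrow> real"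
  assumes compact_K: "compact K" and K_ne: "K \<noteq> {}"
    and contraction_semigroup: "contraction_semigroup_C K S"
    and S_one: "\<And>t x. t \<ge> 0 \<Longrightarrow> x \<in> K \<Longrightarrow> S t (\<lambda>_. 1) x = 1"

lemma
  assumes "contraction_semigroup_C K S"
  shows contraction_semigroup_continuous:
      "t \<ge> 0 \<Longrightarrow> continuous_on K u \<Longrightarrow> continuous_on K (S t u)"
    and contraction_semigroup_linear:
      "t \<ge> 0 \<Longrightarrow> continuous_on K u \<Longrightarrow> continuous_on K v \<Longrightarrow> x \<in> K \<Longrightarrow>
        S t (\<lambda>y. a * u y + b * v y) x = a * S t u x + b * S t v x"
    and contraction_semigroup_SUP:
      "t \<ge> 0 \<Longrightarrow> continuous_on K u \<Longrightarrow> (SUP x\<in>K. \<bar>S t u x\<bar>) \<le> (SUP x\<in>K. \<bar>u x\<bar>)"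
    and contraction_semigroup_zero: "continuous_on K u \<Longrightarrow> x \<in> K \<Longrightarrow> S 0 u x = u x"
    and contraction_semigroup_add:
      "s \<ge> 0 \<Longrightarrow> t \<ge> 0 \<Longrightarrow> continuous_on K u \<Longrightarrow> x \<in> K \<Longrightarrow> S (s + t) u x = S s (S t u) x"
    and contraction_semigroup_right_limit:
      "continuous_on K u \<Longrightarrow> uniform_limit K (\<lambda>t. S t u) u (at_right 0)"
proof -
  note c1 = assms[unfolded contraction_semigroup_C_def]
  note c2 = conjunct2[OF c1] note c3 = conjunct2[OF c2] note c4 = conjunct2[OF c3]
  note c5 = conjunct2[OF c4]
  show "t \<ge> 0 \<Longrightarrow> continuous_on K u \<Longrightarrow> continuous_on K (S t u)"
    using conjunct1[OF c1] by simp
  show "t \<ge> 0 \<Longrightarrow> continuous_on K u \<Longrightarrow> continuous_on K v \<Longrightarrow> x \<in> K \<Longrightarrow>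
      S t (\<lambda>y. a * u y + b * v y) x = a * S t u x + b * S t v x"
    using conjunct1[OF c2] by simp
  show "t \<ge> 0 \<Longrightarrow> continuous_on K u \<Longrightarrow> (SUP x\<in>K. \<bar>S t u x\<bar>) \<le> (SUP x\<in>K. \<bar>u x\<bar>)"
    using conjunct1[OF c3] by simp
  show "continuous_on K u \<Longrightarrow> x \<in> K \<Longrightarrow> S 0 u x = u x"
    using conjunct1[OF c4] by simp
  show "s \<ge> 0 \<Longrightarrow> t \<ge> 0 \<Longrightarrow> continuous_on K u \<Longrightarrow> x \<in> K \<Longrightarrow> S (s + t) u x = S s (S t u) x"
    using conjunct1[OF c5] by blast
  show "continuous_on K u \<Longrightarrow> uniform_limit K (\<lambda>t. S t u) u (at_right 0)"
    using conjunct2[OF c5] by simp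
qed

text \<open>A real \<open>SUP\<close> says something only about sets bounded above, so boundedness
  of \<open>S t u\<close> on \<open>K\<close> comes from continuity and compactness before the
  contraction clause can be read pointwise. The point \<open>x\<close> shows that \<open>K\<close>
  is nonempty, as \<open>cSUP_least\<close> demands.\<close>

lemma contraction_semigroup_bound:
  assumes "contraction_semigroup_C K S" "compact K" "t \<ge> 0" "continuous_on K u"
    and le: "\<And>y. y \<in> K \<Longrightarrow> \<bar>u y\<bar> \<le> M" and "x \<in> K"
  shows "\<bar>S t u x\<bar> \<le> M"
proof -
  have c: "continuous_on K (\<lambda>x. \<bar>S t u x\<bar>)"
    using contraction_semigroup_continuous[OF assms(1,3,4)] by (rule continuous_on_rabs)
  have "bdd_above ((\<lambda>x. \<bar>S t u x\<bar>) ` K)"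
    using compact_continuous_image[OF c assms(2)] by (simp add: bounded_imp_bdd_above compact_imp_bounded)
  then have "\<bar>S t u x\<bar> \<le> (SUP x\<in>K. \<bar>S t u x\<bar>)"
    using cSUP_upper[OF \<open>x \<in> K\<close>, of "\<lambda>x. \<bar>S t u x\<bar>"] by blast
  also have "\<dots> \<le> (SUP x\<in>K. \<bar>u x\<bar>)"
    using contraction_semigroup_SUP[OF assms(1,3,4)] .
  also have "\<dots> \<le> M"
    using le \<open>x \<in> K\<close> by (intro cSUP_least) auto
  finally show ?thesis .
qed

lemma contraction_semigroup_diff:
  assumes "contraction_semigroup_C K S" "compact K" "t \<ge> 0" "continuous_on K u" "continuous_on K v"
    and "\<And>y. y \<in> K \<Longrightarrow> \<bar>u y - v y\<bar> \<le> M" and "x \<in> K"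
  shows "\<bar>S t u x - S t v x\<bar> \<le> M"
proof -
  have "S t (\<lambda>y. u y - v y) x = S t u x - S t v x"
    using contraction_semigroup_linear[OF assms(1,3-5), of x 1 "-1"] \<open>x \<in> K\<close> by simp
  moreover have "\<bar>S t (\<lambda>y. u y - v y) x\<bar> \<le> M"
    using assms(6) by (rule contraction_semigroup_bound[OF assms(1-3) continuous_on_diff[OF assms(4,5)] _ assms(7)])
  ultimately show ?thesis by simp
qed

text \<open>Strong right continuity at 0 implies two-sided strong continuity, as the maps are contractions.\<close>

lemma contraction_semigroup_time_diff:
  assumes C: "contraction_semigroup_C K S" "compact K" and "a \<ge> 0" "b \<ge> 0" and u: "continuous_on K u"
    and M: "\<And>y. y \<in> K \<Longrightarrow> \<bar>S \<bar>a - b\<bar> u y - u y\<bar> \<le> M" and "x \<in> K"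
  shows "\<bar>S a u x - S b u x\<bar> \<le> M"
proof -
  have ordered: "\<bar>S a u x - S b u x\<bar> \<le> M"
    if "b \<ge> 0" "b \<le> a" and M: "\<And>y. y \<in> K \<Longrightarrow> \<bar>S \<bar>a - b\<bar> u y - u y\<bar> \<le> M" for a b
  proof -
    have "S (b + (a - b)) u x = S b (S (a - b) u) x"
      using that u \<open>x \<in> K\<close> by (intro contraction_semigroup_add[OF C(1)]) auto
    moreover have "\<bar>S b (S (a - b) u) x - S b u x\<bar> \<le> M"
    proof (rule contraction_semigroup_diff[OF C])
      show "continuous_on K (S (a - b) u)"
        using that u by (intro contraction_semigroup_continuous[OF C(1)]) auto
      show "\<bar>S (a - b) u y - u y\<bar> \<le> M" if "y \<in> K" for y
        using M[OF that] \<open>b \<le> a\<close> by simp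
    qed (use that u \<open>x \<in> K\<close> in auto)
    ultimately show ?thesis by simp
  qed
  show ?thesis
  proof (cases "b \<le> a")
    case True
    then show ?thesis using ordered[OF \<open>b \<ge> 0\<close> _ M] by simp
  next
    case False
    have "\<bar>S b u x - S a u x\<bar> \<le> M"
      using False M by (intro ordered[OF \<open>a \<ge> 0\<close>]) (auto simp: abs_minus_commute)
    then show ?thesis by (simp add: abs_minus_commute)
  qed
qed

context markov_semigroup
begin

lemmas S_continuous = contraction_semigroup_continuous[OF contraction_semigroup]
lemmas S_linear = contraction_semigroup_linear[OF contraction_semigroup]
lemmas S_zero = contraction_semigroup_zero[OF contraction_semigroup]
lemmas S_add = contraction_semigroup_add[OF contraction_semigroup]
lemmas S_right_limit = contraction_semigroup_right_limit[OF contraction_semigroup]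
lemmas S_bound = contraction_semigroup_bound[OF contraction_semigroup compact_K]
lemmas S_diff = contraction_semigroup_diff[OF contraction_semigroup compact_K]
lemmas S_time_diff = contraction_semigroup_time_diff[OF contraction_semigroup compact_K]

text \<open>States are total functions whose values off \<open>K\<close> are irrelevant, but
  \<open>S t\<close> could a priori depend on those values. The contraction estimate with bound 0
  excludes this.\<close>

lemma S_cong:
  assumes "t \<ge> 0" "continuous_on K u" "\<And>y. y \<in> K \<Longrightarrow> u y = v y" "x \<in> K"
  shows "S t u x = S t v x"
proof -
  have "continuous_on K v"
    using assms(2,3) by (simp cong: continuous_on_cong)
  then show ?thesis
    using S_diff[of t u v 0 x] assms by simp
qed

lemma S_affine:
  assumes "t \<ge> 0" "continuous_on K u" "x \<in> K"
  shows "S t (\<lambda>y. a * u y + b) x = a * S t u x + b"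
  using S_linear[of t u "\<lambda>_. 1" x a b] S_one[of t x] assms by simp

lemma S_const: "t \<ge> 0 \<Longrightarrow> x \<in> K \<Longrightarrow> S t (\<lambda>_. c) x = c"
  using S_affine[of t "\<lambda>_. 1" x 0 c] by simp

text \<open>If \<open>u\<close> takes values in \<open>[m, k]\<close>, subtracting the midpoint
  \<open>(m + k) / 2\<close> leaves a function of modulus at most \<open>(k - m) / 2\<close>.
  Contractivity preserves this two-sided bound, and adding the preserved constant back gives the
  one-sided one.\<close>

lemma S_upper:
  assumes t: "t \<ge> 0" and u: "continuous_on K u" and k: "\<And>y. y \<in> K \<Longrightarrow> u y \<le> k" and x: "x \<in> K"
  shows "S t u x \<le> k"
proof -
  obtain m where m: "\<And>y. y \<in> K \<Longrightarrow> m \<le> u y"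
    using continuous_attains_inf[OF compact_K K_ne u] by blast
  have "\<bar>S t (\<lambda>y. 1 * u y + (- (m + k) / 2)) x\<bar> \<le> (k - m) / 2"
  proof (rule S_bound[OF t _ _ x])
    show "\<bar>1 * u y + - (m + k) / 2\<bar> \<le> (k - m) / 2" if "y \<in> K" for y
      using m[OF that] k[OF that] by (simp add: abs_le_iff field_simps)
    show "continuous_on K (\<lambda>y. 1 * u y + - (m + k) / 2)"
      by (intro continuous_intros u)
  qed
  then show ?thesis
    using S_affine[OF t u x, of 1 "- (m + k) / 2"] by (simp add: abs_le_iff field_simps)
qed

text \<open>The increment splits into \<open>S (t - s')\<close> applied to
  \<open>g s' - g s\<close>, controlled by contractivity, and a time shift acting on the fixed
  function \<open>g s\<close>, controlled by strong continuity.\<close>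

lemma S_convolution_continuous:
  assumes g: "continuous_on ({0..r} \<times> K) (\<lambda>(s, x). g s x)" and "r \<le> t"
  shows "continuous_on ({0..r} \<times> K) (\<lambda>(s, x). S (t - s) (g s) x)"
proof (rule uniform_limit_joint_continuous)
  have gc: "continuous_on K (g s)" if "s \<in> {0..r}" for s
    using continuous_on_slice1[OF g that] .
  show "continuous_on K (S (t - s) (g s))" if "s \<in> {0..r}" for s
    using that assms(2) gc by (auto intro: S_continuous)
  show "uniform_limit K (\<lambda>s. S (t - s) (g s)) (S (t - s) (g s)) (at s within {0..r})"
    if s: "s \<in> {0..r}" for s
  proof (rule uniform_limitI)
    fix e :: real assume "e > 0"
    have 1: "\<forall>\<^sub>F s' in at s within {0..r}. \<forall>y\<in>K. dist (g s' y) (g s y) < e / 2"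
      using uniform_limitD[OF joint_continuous_uniform_limit[OF g compact_K s], of "e / 2"] \<open>e > 0\<close> by simp
    have "\<forall>\<^sub>F h in at_right 0. \<forall>y\<in>K. dist (S h (g s) y) (g s y) < e / 2"
      using uniform_limitD[OF S_right_limit[OF gc[OF s]], of "e / 2"] \<open>e > 0\<close> by simp
    then obtain d where d: "d > 0" "\<And>h y. 0 < h \<Longrightarrow> h < d \<Longrightarrow> y \<in> K \<Longrightarrow> \<bar>S h (g s) y - g s y\<bar> < e / 2"
      unfolding eventually_at_right_field dist_real_def by metis
    have "\<forall>\<^sub>F s' in at s within {0..r}. s' \<noteq> s \<and> s' \<in> {0..r} \<and> \<bar>s' - s\<bar> < d"
      unfolding eventually_at using d(1) by (auto simp: dist_real_def)
    with 1 show "\<forall>\<^sub>F s' in at s within {0..r}.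
        \<forall>x\<in>K. dist (S (t - s') (g s') x) (S (t - s) (g s) x) < e"
    proof eventually_elim
      case (elim s')
      show ?case
      proof
        fix x assume x: "x \<in> K"
        \<comment> \<open>The maximum over compact \<open>K\<close> is attained and so stays
          strictly below \<open>e / 2\<close>; the second half of the estimate is only a weak
          inequality.\<close>
        obtain m where m: "m < e / 2" "\<And>y. y \<in> K \<Longrightarrow> \<bar>g s' y - g s y\<bar> \<le> m"
        proof -
          have c: "continuous_on K (\<lambda>y. \<bar>g s' y - g s y\<bar>)"
            using gc elim s by (intro continuous_intros) auto
          obtain z where "z \<in> K" "\<And>y. y \<in> K \<Longrightarrow> \<bar>g s' y - g s y\<bar> \<le> \<bar>g s' z - g s z\<bar>"
            using continuous_attains_sup[OF compact_K K_ne c] by blast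
          then show ?thesis
            using elim that[of "\<bar>g s' z - g s z\<bar>"] by (auto simp: dist_real_def)
        qed
        have "\<bar>S (t - s') (g s') x - S (t - s') (g s) x\<bar> \<le> m"
          using m(2) elim s \<open>r \<le> t\<close> gc x by (intro S_diff) auto
        moreover have "\<bar>S (t - s') (g s) x - S (t - s) (g s) x\<bar> \<le> e / 2"
        proof (rule S_time_diff)
          show "\<bar>S \<bar>t - s' - (t - s)\<bar> (g s) y - g s y\<bar> \<le> e / 2" if "y \<in> K" for y
            using d(2)[of "\<bar>s' - s\<bar>" y] elim that
            by (simp add: abs_minus_commute less_imp_le)
        qed (use elim s \<open>r \<le> t\<close> gc x in auto)
        ultimately show "dist (S (t - s') (g s') x) (S (t - s) (g s) x) < e"
          using m(1) unfolding dist_real_def by linarith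
      qed
    qed
  qed
qed

text \<open>
  Since \<open>S h\<close> is bounded, the integral of \<open>S h \<circ> G\<close> up to \<open>\<rho>\<close> and \<open>S h\<close> of the integral of \<open>G\<close> up to
  \<open>\<rho>\<close> have the same derivative in \<open>\<rho>\<close>. This avoids vector-valued integrals in \<open>C(K)\<close>.
\<close>

lemma S_integral:
  fixes G :: "real \<Rightarrow> 'a \<Rightarrow> real"
  assumes h: "h \<ge> 0" and G: "continuous_on ({0..r} \<times> K) (\<lambda>(s, x). G s x)" and "r \<ge> 0" and x: "x \<in> K"
  shows "S h (\<lambda>y. integral {0..r} (\<lambda>s. G s y)) x = integral {0..r} (\<lambda>s. S h (G s) x)"
proof -
  have Gc: "continuous_on K (G s)" if "s \<in> {0..r}" for s
    using continuous_on_slice1[OF G that] .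
  have Gt: "continuous_on {0..r} (\<lambda>s. G s y)" if "y \<in> K" for y
    using continuous_on_slice2[OF G that] .
  define J where "J \<rho> y = integral {0..\<rho>} (\<lambda>s. G s y)" for \<rho> y
  have J: "continuous_on K (J \<rho>)" if "\<rho> \<in> {0..r}" for \<rho>
  proof -
    have "continuous_on (K \<times> {0..\<rho>}) ((\<lambda>(s, x). G s x) \<circ> prod.swap)"
      using that by (intro continuous_on_compose continuous_on_swap continuous_on_subset[OF G]) auto
    then have "continuous_on (K \<times> {0..\<rho>}) (\<lambda>(x, s). G s x)"
      by (simp add: comp_def case_prod_unfold)
    from integral_continuous_on_param[of K 0 \<rho>, unfolded box_real, OF this] show ?thesis
      by (simp add: J_def[abs_def])
  qed
  have "((\<lambda>\<rho>. S h (J \<rho>) x) has_vector_derivative S h (G \<rho>) x) (at \<rho> within {0..r})"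
    if \<rho>: "\<rho> \<in> {0..r}" for \<rho>
    unfolding has_vector_derivative_def has_derivative_within_alt2
  proof (intro conjI allI impI)
    fix e :: real assume "e > 0"
    then have "\<forall>\<^sub>F s in at \<rho> within {0..r}. \<forall>y\<in>K. dist (G s y) (G \<rho> y) < e"
      using uniform_limitD[OF joint_continuous_uniform_limit[OF G compact_K \<rho>]] by blast
    then obtain d where d: "d > 0"
      "\<And>s y. s \<in> {0..r} \<Longrightarrow> s \<noteq> \<rho> \<Longrightarrow> \<bar>s - \<rho>\<bar> < d \<Longrightarrow> y \<in> K \<Longrightarrow> \<bar>G s y - G \<rho> y\<bar> < e"
      unfolding eventually_at dist_real_def by metis
    have "\<forall>\<^sub>F b in at \<rho> within {0..r}. b \<in> {0..r} \<and> \<bar>b - \<rho>\<bar> < d"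
      unfolding eventually_at using d(1) by (auto simp: dist_real_def)
    then show "\<forall>\<^sub>F b in at \<rho> within {0..r}.
        norm (S h (J b) x - S h (J \<rho>) x - (b - \<rho>) *\<^sub>R S h (G \<rho>) x) \<le> e * norm (b - \<rho>)"
    proof eventually_elim
      case (elim b)
      \<comment> \<open>The error of the first-order expansion of \<open>J\<close>, small uniformly
        on \<open>K\<close> before \<open>S h\<close> is applied. The coefficients are spelled out
        so that two uses of \<open>S_linear\<close> take it apart.\<close>
      have "\<bar>S h (\<lambda>y. 1 * (1 * J b y + (-1) * J \<rho> y) + (- (b - \<rho>)) * G \<rho> y) x\<bar> \<le> e * \<bar>b - \<rho>\<bar>"
      proof (rule S_bound[OF h _ _ x])
        fix y assume y: "y \<in> K"
        have "\<bar>J b y - J \<rho> y - (b - \<rho>) * G \<rho> y\<bar> \<le> e * \<bar>b - \<rho>\<bar>"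
          unfolding J_def
        proof (rule indefinite_integral_linear_approx[OF Gt[OF y] \<rho>])
          fix s assume "s \<in> closed_segment \<rho> b"
          then have s: "s \<in> {0..r}" "\<bar>s - \<rho>\<bar> < d"
            using elim \<rho> by (auto simp: closed_segment_eq_real_ivl split: if_splits)
          show "\<bar>G s y - G \<rho> y\<bar> \<le> e"
            using d(2)[OF s(1) _ s(2) y] \<open>e > 0\<close> by (cases "s = \<rho>") auto
        qed (use elim in auto)
        then show "\<bar>1 * (1 * J b y + - 1 * J \<rho> y) + - (b - \<rho>) * G \<rho> y\<bar> \<le> e * \<bar>b - \<rho>\<bar>"
          by (simp add: algebra_simps)
      next
        show "continuous_on K (\<lambda>y. 1 * (1 * J b y + - 1 * J \<rho> y) + - (b - \<rho>) * G \<rho> y)"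
          using elim \<rho> by (intro continuous_intros J Gc) auto
      qed
      also have "S h (\<lambda>y. 1 * (1 * J b y + (-1) * J \<rho> y) + (- (b - \<rho>)) * G \<rho> y) x
          = S h (J b) x - S h (J \<rho>) x - (b - \<rho>) * S h (G \<rho>) x"
        using S_linear[OF h _ Gc[OF \<rho>] x, of "\<lambda>y. 1 * J b y + (-1) * J \<rho> y" 1 "- (b - \<rho>)"]
          S_linear[OF h J[of b] J[OF \<rho>] x, of 1 "-1"] elim J \<rho>
        by (simp add: continuous_on_diff algebra_simps)
      finally show ?case by simp
    qed
  qed (rule bounded_linear_scaleR_left)
  then have "((\<lambda>\<rho>. S h (G \<rho>) x) has_integral S h (J r) x - S h (J 0) x) {0..r}"
    using \<open>r \<ge> 0\<close> by (intro fundamental_theorem_of_calculus) auto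
  moreover have "S h (J 0) x = 0"
    using S_const[OF h x, of 0] by (simp add: J_def[abs_def])
  ultimately show ?thesis
    by (simp add: integral_unique J_def[abs_def])
qed

end

section \<open>One-sided bounds for mild solutions, and the field near the box\<close>

lemma forward_interval_Icc:
  assumes "t \<in> forward_interval T" shows "{0..t} \<subseteq> forward_interval T"
proof
  fix s assume "s \<in> {0..t}"
  then show "s \<in> forward_interval T"
    using assms le_less_trans[of "ereal s" "ereal t" T] by (simp add: forward_interval_def)
qed

lemma mild_solution_joint_continuous:
  assumes "mild_solution K S F T U"
  shows "continuous_on (forward_interval T \<times> K) (\<lambda>(s, x). U s x)"
  using assms unfolding mild_solution_def by (intro uniform_limit_joint_continuous) auto

text \<open>The library's \<open>local_lipschitz\<close> concerns time-dependent fields; the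
  one-point time set \<open>{0}\<close> makes an autonomous field an instance. Closed balls of half
  the radius fit into the open balls of the hypothesis.\<close>

lemma locally_lipschitz_compact:
  assumes "locally_lipschitz F" "compact B"
  obtains L where "L-lipschitz_on B F"
proof -
  have "local_lipschitz {0::real} B (\<lambda>_. F)"
  proof (rule local_lipschitzI)
    fix x
    obtain r L where "r > 0" "L-lipschitz_on (ball x r) F"
      using assms(1) unfolding locally_lipschitz_def by blast
    then have "L-lipschitz_on (cball x (r / 2) \<inter> B) F"
      by (elim lipschitz_on_subset) auto
    then show "\<exists>u>0. \<exists>L. \<forall>t\<in>cball t u \<inter> {0}. L-lipschitz_on (cball x u \<inter> B) F" for t :: real
      using \<open>r > 0\<close> half_gt_zero by blast
  qed
  from local_lipschitz_compact_implies_lipschitz[OF this assms(2)] show ?thesis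
    using that by auto
qed

lemma locally_lipschitz_continuous:
  assumes "locally_lipschitz F"
  shows "continuous_on UNIV F"
proof (rule continuous_at_imp_continuous_on, rule ballI)
  fix x
  obtain r L where "r > 0" "L-lipschitz_on (ball x r) F"
    using assms unfolding locally_lipschitz_def by blast
  then show "isCont F x"
    using continuous_on_interior[OF lipschitz_on_continuous_on, of L "ball x r" F x] by simp
qed

context markov_semigroup
begin

text \<open>
  The function \<open>\<lambda>r. exp (l * r) * S (t - r) (u r) x\<close> interpolates between the initial value and
  \<open>u t x\<close>, and its derivative is \<open>exp (l * r) * S (t - r) (f r + l * u r) x\<close>.
\<close>

lemma mild_upper_bound:
  fixes u f :: "real \<Rightarrow> 'a \<Rightarrow> real"
  assumes t: "t \<ge> 0"
    and u: "continuous_on ({0..t} \<times> K) (\<lambda>(s, x). u s x)"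
    and f: "continuous_on ({0..t} \<times> K) (\<lambda>(s, x). f s x)"
    and mild: "\<And>r x. r \<in> {0..t} \<Longrightarrow> x \<in> K \<Longrightarrow>
        u r x = S r (u 0) x + integral {0..r} (\<lambda>s. S (r - s) (f s) x)"
    and init: "\<And>x. x \<in> K \<Longrightarrow> u 0 x \<le> 0"
    and le: "\<And>r x. r \<in> {0..t} \<Longrightarrow> x \<in> K \<Longrightarrow> f r x + l * u r x \<le> C * exp (m * r)"
    and "l + m > 0" "C \<ge> 0" and x: "x \<in> K"
  shows "u t x \<le> C / (l + m) * exp (m * t)"
proof -
  have uc: "continuous_on K (u r)" and fc: "continuous_on K (f r)" if "r \<in> {0..t}" for r
    using continuous_on_slice1[OF u that] continuous_on_slice1[OF f that] .
  define q where "q r = S (t - r) (u r) x" for r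
  \<comment> \<open>Applying \<open>S (t - r)\<close> to the mild formula at time \<open>r\<close>
    and using the semigroup law leaves \<open>r\<close> only in the upper limit of the integral.
    Hence \<open>q\<close> is differentiable even though the orbits of \<open>S\<close> need not
    be.\<close>
  have q_eq: "q r = S t (u 0) x + integral {0..r} (\<lambda>s. S (t - s) (f s) x)" if r: "r \<in> {0..t}" for r
  proof -
    have f': "continuous_on ({0..r} \<times> K) (\<lambda>(s, x). S (r - s) (f s) x)"
      using r by (intro S_convolution_continuous continuous_on_subset[OF f]) auto
    define J where "J y = integral {0..r} (\<lambda>s. S (r - s) (f s) y)" for y
    have eq: "u r y = 1 * S r (u 0) y + 1 * J y" if "y \<in> K" for y
      using mild[OF r that] by (simp add: J_def)
    have S0: "continuous_on K (S r (u 0))"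
      using r uc[of 0] t by (intro S_continuous) auto
    \<comment> \<open>By the mild formula \<open>J\<close> is the difference of two functions
      already known to be continuous.\<close>
    have J: "continuous_on K J"
    proof -
      have "continuous_on K (\<lambda>y. u r y - S r (u 0) y)"
        by (intro continuous_on_diff uc r S0)
      then show ?thesis
        by (rule continuous_on_eq) (simp add: eq)
    qed
    have "q r = S (t - r) (\<lambda>y. 1 * S r (u 0) y + 1 * J y) x"
      unfolding q_def using r x by (intro S_cong uc eq) auto
    also have "\<dots> = S (t - r) (S r (u 0)) x + S (t - r) J x"
      using S_linear[OF _ S0 J x, of "t - r" 1 1] r by simp
    also have "S (t - r) (S r (u 0)) x = S t (u 0) x"
      using S_add[of "t - r" r "u 0" x] r x uc[of 0] by simp
    also have "S (t - r) J x = integral {0..r} (\<lambda>s. S (t - r) (S (r - s) (f s)) x)"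
      unfolding J_def using r x by (intro S_integral f') auto
    also have "\<dots> = integral {0..r} (\<lambda>s. S (t - s) (f s) x)"
    proof (rule integral_cong)
      fix s assume "s \<in> {0..r}"
      then show "S (t - r) (S (r - s) (f s)) x = S (t - s) (f s) x"
        using S_add[of "t - r" "r - s" "f s" x] r x fc[of s] by simp
    qed
    finally show ?thesis .
  qed
  have "continuous_on {0..t} (\<lambda>s. S (t - s) (f s) x)"
    using continuous_on_slice2[OF S_convolution_continuous[OF f order_refl] x] .
  then have dq: "(q has_vector_derivative S (t - r) (f r) x) (at r within {0..t})" if r: "r \<in> {0..t}" for r
    using has_vector_derivative_transform[OF r q_eq
        has_vector_derivative_add[OF has_vector_derivative_const integral_has_vector_derivative[OF _ r]]]
    by simp
  have exp_eq: "exp ((l + m) * r) = exp (l * r) * exp (m * r)" for r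
    by (simp add: distrib_right exp_add)
  define p where "p r = exp (l * r) * q r" for r
  have "(p has_vector_derivative exp (l * r) * (l * q r + S (t - r) (f r) x)) (at r within {0..t})"
    if "r \<in> {0..t}" for r
  proof -
    have "((\<lambda>r. exp (l * r)) has_real_derivative exp (l * r) * l) (at r within {0..t})"
      by (auto intro!: derivative_eq_intros)
    moreover have "(q has_real_derivative S (t - r) (f r) x) (at r within {0..t})"
      using dq[OF that] by (simp add: has_real_derivative_iff_has_vector_derivative)
    ultimately have "(p has_real_derivative
        exp (l * r) * l * q r + S (t - r) (f r) x * exp (l * r)) (at r within {0..t})"
      unfolding p_def by (rule DERIV_mult)
    then show ?thesis
      by (simp add: has_real_derivative_iff_has_vector_derivative algebra_simps)
  qed
  then have 1: "((\<lambda>r. exp (l * r) * (l * q r + S (t - r) (f r) x)) has_integral p t - p 0) {0..t}"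
    by (rule fundamental_theorem_of_calculus[OF t])
  \<comment> \<open>The bound assumed on \<open>f + l u\<close>, multiplied by the weight
    \<open>exp (l * r)\<close>. Its antiderivative is the origin of the constant
    \<open>C / (l + m)\<close>.\<close>
  have 2: "((\<lambda>r. C * exp ((l + m) * r)) has_integral
      C / (l + m) * exp ((l + m) * t) - C / (l + m) * exp ((l + m) * 0)) {0..t}"
  proof (rule fundamental_theorem_of_calculus[OF t])
    fix r
    have "((\<lambda>r. C / (l + m) * exp ((l + m) * r)) has_real_derivative
        C / (l + m) * (exp ((l + m) * r) * (l + m))) (at r within {0..t})"
      by (intro DERIV_cmult) (auto intro!: derivative_eq_intros)
    then show "((\<lambda>r. C / (l + m) * exp ((l + m) * r)) has_vector_derivative
        C * exp ((l + m) * r)) (at r within {0..t})"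
      using \<open>l + m > 0\<close> by (simp add: has_real_derivative_iff_has_vector_derivative)
  qed
  have "p t - p 0 \<le> C / (l + m) * exp ((l + m) * t) - C / (l + m) * exp ((l + m) * 0)"
  proof (rule has_integral_le[OF 1 2])
    fix r assume r: "r \<in> {0..t}"
    have "l * q r + S (t - r) (f r) x = S (t - r) (\<lambda>y. l * u r y + 1 * f r y) x"
      using S_linear[OF _ uc[OF r] fc[OF r] x, of "t - r" l 1] r by (simp add: q_def)
    also have "\<dots> \<le> C * exp (m * r)"
    proof (rule S_upper)
      show "l * u r y + 1 * f r y \<le> C * exp (m * r)" if "y \<in> K" for y
        using le[OF r that] by simp
    qed (use r x uc fc in \<open>auto intro!: continuous_on_add continuous_on_mult_left\<close>)
    finally have "exp (l * r) * (l * q r + S (t - r) (f r) x) \<le> exp (l * r) * (C * exp (m * r))"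
      by (intro mult_left_mono) auto
    then show "exp (l * r) * (l * q r + S (t - r) (f r) x) \<le> C * exp ((l + m) * r)"
      unfolding exp_eq by (simp add: mult_ac)
  qed
  moreover have "p 0 \<le> 0"
    unfolding p_def q_def using S_upper[of t "u 0" 0 x] uc[of 0] t init x by simp
  moreover have "C / (l + m) * exp ((l + m) * 0) \<ge> 0"
    using assms by simp
  ultimately have "p t \<le> C / (l + m) * exp ((l + m) * t)" by linarith
  moreover have "p t = exp (l * t) * u t x"
    unfolding p_def q_def using S_zero[OF uc[of t] x] t by simp
  ultimately have "exp (l * t) * u t x \<le> exp (l * t) * (C / (l + m) * exp (m * t))"
    unfolding exp_eq by (simp add: mult_ac)
  then show ?thesis
    by (simp only: mult_le_cancel_left_pos exp_gt_zero)
qed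

end

text \<open>Let \<open>w\<close> be \<open>v\<close> clamped to the box coordinatewise. Every
  coordinate moves by at most \<open>E\<close>, so \<open>F v\<close> and \<open>F w\<close> differ
  by at most \<open>L * CARD('n) * E\<close>. Moving \<open>w\<close> to the upper face costs
  \<open>L * (\<beta> $ i - w $ i)\<close>, and on the face the sign is known. After adding
  \<open>L * (v $ i - \<beta> $ i)\<close> only \<open>L * (v $ i - w $ i)\<close> remains, which
  contributes the last \<open>L * E\<close>. The lower face is symmetric.\<close>

lemma inward_field_estimate:
  fixes F :: "real^'n \<Rightarrow> real^'n"
  assumes L: "L-lipschitz_on B F" and B: "{w. \<forall>j. w $ j \<in> {\<alpha> $ j..\<beta> $ j}} \<subseteq> B" "v \<in> B"
    and le: "\<And>j. \<alpha> $ j \<le> \<beta> $ j"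
    and R: "R_inf F \<alpha> \<beta>" "R_sup F \<alpha> \<beta>" and "E \<ge> 0"
    and E: "\<And>j. v $ j - \<beta> $ j \<le> E" "\<And>j. \<alpha> $ j - v $ j \<le> E"
  shows "F v $ i + L * (v $ i - \<beta> $ i) \<le> L * (CARD('n) + 1) * E"
    and "- F v $ i + L * (\<alpha> $ i - v $ i) \<le> L * (CARD('n) + 1) * E"
proof -
  define w where "w = (\<chi> j. max (\<alpha> $ j) (min (v $ j) (\<beta> $ j)))"
  have w: "w $ j \<in> {\<alpha> $ j..\<beta> $ j}" "\<bar>v $ j - w $ j\<bar> \<le> E" for j
    using le[of j] E[of j] \<open>E \<ge> 0\<close> by (auto simp: w_def max_def min_def)
  have "L \<ge> 0" using L by (rule lipschitz_on_nonneg)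
  have "norm (v - w) \<le> (\<Sum>j\<in>UNIV. \<bar>(v - w) $ j\<bar>)"
    by (rule norm_le_l1_cart)
  also have "\<dots> \<le> (\<Sum>j\<in>(UNIV::'n set). E)"
    using w(2) by (intro sum_mono) simp
  finally have "norm (v - w) \<le> CARD('n) * E" by simp
  moreover have "w \<in> B" using w B(1) by blast
  ultimately have "norm (F v - F w) \<le> L * (CARD('n) * E)"
    using lipschitz_on_normD[OF L B(2), of w] mult_left_mono[OF _ \<open>L \<ge> 0\<close>] by fastforce
  then have 1: "\<bar>F v $ i - F w $ i\<bar> \<le> L * (CARD('n) * E)"
    using component_le_norm_cart[of "F v - F w" i] by simp
  have 2: "\<bar>F w $ i - F (\<chi> j. if j = i then c else w $ j) $ i\<bar> \<le> L * \<bar>w $ i - c\<bar>"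
    if "c \<in> {\<alpha> $ i..\<beta> $ i}" for c
  proof -
    let ?w = "\<chi> j. if j = i then c else w $ j"
    have "w - ?w = (w $ i - c) *\<^sub>R axis i 1"
      by (simp add: vec_eq_iff axis_def)
    moreover have "?w \<in> B" using w that B(1) by auto
    ultimately have "norm (F w - F ?w) \<le> L * \<bar>w $ i - c\<bar>"
      using lipschitz_on_normD[OF L \<open>w \<in> B\<close>, of ?w] by (simp add: norm_axis_1)
    then show ?thesis
      using component_le_norm_cart[of "F w - F ?w" i] by simp
  qed
  have 3: "F (\<chi> j. if j = i then \<beta> $ i else w $ j) $ i \<le> 0"
    "F (\<chi> j. if j = i then \<alpha> $ i else w $ j) $ i \<ge> 0"
    using R w(1) unfolding R_inf_def R_sup_def by blast+
  have "F v $ i + L * (v $ i - \<beta> $ i) \<le> L * (CARD('n) * E) + L * (v $ i - w $ i)"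
    using 1 2[of "\<beta> $ i"] 3(1) w(1)[of i] le[of i] by (simp add: algebra_simps abs_le_iff)
  moreover have "L * (v $ i - w $ i) \<le> L * E"
    using w(2)[of i] \<open>L \<ge> 0\<close> by (intro mult_left_mono) auto
  ultimately show "F v $ i + L * (v $ i - \<beta> $ i) \<le> L * (CARD('n) + 1) * E"
    by (simp add: algebra_simps)
  have "- F v $ i + L * (\<alpha> $ i - v $ i) \<le> L * (CARD('n) * E) + L * (w $ i - v $ i)"
    using 1 2[of "\<alpha> $ i"] 3(2) w(1)[of i] le[of i] by (simp add: algebra_simps abs_le_iff)
  moreover have "L * (w $ i - v $ i) \<le> L * E"
    using w(2)[of i] \<open>L \<ge> 0\<close> by (intro mult_left_mono) auto
  ultimately show "- F v $ i + L * (\<alpha> $ i - v $ i) \<le> L * (CARD('n) + 1) * E"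
    by (simp add: algebra_simps)
qed

section \<open>Maximal trajectories\<close>

lemma forward_interval_mono: "T \<le> T' \<Longrightarrow> forward_interval T \<subseteq> forward_interval T'"
  unfolding forward_interval_def using order_less_le_trans by blast

text \<open>An interval determines its right end only if it is nonempty, hence \<open>0 < T\<close>.
  Taking \<open>max 0 T'\<close> places the separating point \<open>z\<close> at a nonnegative
  time.\<close>

lemma forward_interval_subset_imp_le:
  assumes "0 < T" and sub: "forward_interval T \<subseteq> forward_interval T'"
  shows "T \<le> T'"
proof (rule ccontr)
  assume "\<not> T \<le> T'"
  then have "max 0 T' < T" using \<open>0 < T\<close> by auto
  then obtain z where z: "max 0 T' < ereal z" "ereal z < T"
    using ereal_dense2 by blast
  then have "z \<in> forward_interval T" by (auto simp: forward_interval_def)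
  then have "z \<in> forward_interval T'" using sub by blast
  then show False using z by (auto simp: forward_interval_def)
qed

text \<open>Forward intervals are open on the right, so the smaller one is a neighbourhood of
  \<open>t\<close> in the larger one. Limits and derivatives therefore survive both restriction and
  gluing.\<close>

lemma at_within_forward_interval:
  assumes "t \<in> forward_interval T'" "T' \<le> T"
  shows "at t within forward_interval T = at t within forward_interval T'"
proof (rule at_within_nhd)
  show "t \<in> ereal -` {..<T'}" using assms by (simp add: forward_interval_def)
  show "open (ereal -` {..<T'})" by (rule open_ereal_vimage) simp
  show "forward_interval T \<inter> ereal -` {..<T'} - {t} = forward_interval T' \<inter> ereal -` {..<T'} - {t}"
    using assms(2) order_less_le_trans by (fastforce simp: forward_interval_def)
qed

text \<open>Zorn's lemma, applied to the graphs of trajectories ordered by inclusion.\<close>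

lemma maximal_trajectory_extension:
  assumes restrict: "\<And>T v T' w. sol T v \<Longrightarrow> T' \<le> T \<Longrightarrow>
      (\<And>t. t \<in> forward_interval T' \<Longrightarrow> eq (v t) (w t)) \<Longrightarrow> sol T' w"
    and union: "\<And>T v. (\<And>t. t \<in> forward_interval T \<Longrightarrow>
      \<exists>T'\<le>T. t \<in> forward_interval T' \<and> sol T' v) \<Longrightarrow> sol T v"
    and refl: "\<And>x. eq x x"
    and T0: "0 < T0" and u: "sol T0 u"
  shows "\<exists>T v. T0 \<le> T \<and> maximal_trajectory eq sol T v \<and> (\<forall>t\<in>forward_interval T0. v t = u t)"
proof -
  define graph where "graph T v = (\<lambda>t. (t, v t)) ` forward_interval T" for T and v :: "real \<Rightarrow> 'a"
  have graph_iff: "(t, y) \<in> graph T v \<longleftrightarrow> t \<in> forward_interval T \<and> y = v t" for t y T and v :: "real \<Rightarrow> 'a"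
    by (auto simp: graph_def)
  \<comment> \<open>Inclusion of graphs compares values by HOL equality, while maximality is stated
    with \<open>eq\<close>; the modification \<open>w'\<close> below bridges the two.\<close>
  define \<A> where "\<A> = {graph T v | T v. 0 < T \<and> sol T v \<and> graph T0 u \<subseteq> graph T v}"
  have "\<exists>M\<in>\<A>. \<forall>X\<in>\<A>. M \<subseteq> X \<longrightarrow> X = M"
  proof (rule subset_Zorn_nonempty)
    show "\<A> \<noteq> {}" using T0 u by (auto simp: \<A>_def)
    fix \<C> assume ne: "\<C> \<noteq> {}" and chain: "subset.chain \<A> \<C>"
    define \<T> where "\<T> = {T. \<exists>v. 0 < T \<and> sol T v \<and> graph T v \<in> \<C>}"
    \<comment> \<open>The supremum may be infinite or not attained. As forward intervals exclude
      their right end, the intervals of the chain still fill exactly that of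
      \<open>Tm\<close>.\<close>
    define Tm where "Tm = Sup \<T>"
    define w where "w t = (SOME y. (t, y) \<in> \<Union>\<C>)" for t
    have memb: "\<exists>T v. G = graph T v \<and> 0 < T \<and> sol T v \<and> graph T0 u \<subseteq> graph T v" if "G \<in> \<C>" for G
      using that chain unfolding subset_chain_def \<A>_def by blast
    have fun_eq: "y = z" if "(t, y) \<in> \<Union>\<C>" "(t, z) \<in> \<Union>\<C>" for t y z
    proof -
      obtain G H where GH: "G \<in> \<C>" "H \<in> \<C>" "(t, y) \<in> G" "(t, z) \<in> H" using \<open>(t, y) \<in> \<Union>\<C>\<close> \<open>(t, z) \<in> \<Union>\<C>\<close> by blast
      then have "G \<subseteq> H \<or> H \<subseteq> G" using chain unfolding subset_chain_def by blast
      then obtain L where "L \<in> \<C>" "(t, y) \<in> L" "(t, z) \<in> L" using GH by blast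
      then show ?thesis using memb[OF \<open>L \<in> \<C>\<close>] graph_iff by metis
    qed
    have w: "y = w t" if "(t, y) \<in> \<Union>\<C>" for t y
      unfolding w_def using someI[of "\<lambda>y. (t, y) \<in> \<Union>\<C>", OF that] that fun_eq by blast
    have agree: "v t = w t" if "graph T v \<in> \<C>" "t \<in> forward_interval T" for T v t
    proof -
      have "(t, v t) \<in> graph T v" using that(2) by (simp add: graph_iff)
      then show ?thesis using w that(1) by blast
    qed
    have "sol Tm w"
    proof (rule union)
      fix t assume "t \<in> forward_interval Tm"
      then have "ereal t < Sup \<T>" "0 \<le> t" by (auto simp: forward_interval_def Tm_def)
      then obtain T where "T \<in> \<T>" "ereal t < T" by (auto simp: less_Sup_iff)
      then obtain v where v: "sol T v" "graph T v \<in> \<C>" by (auto simp: \<T>_def)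
      have "T \<le> Tm" using \<open>T \<in> \<T>\<close> by (simp add: Tm_def Sup_upper)
      moreover have "t \<in> forward_interval T"
        using \<open>ereal t < T\<close> \<open>0 \<le> t\<close> by (simp add: forward_interval_def)
      moreover have "sol T w"
        using v(1)
      proof (rule restrict)
        show "eq (v s) (w s)" if "s \<in> forward_interval T" for s
          using agree[OF v(2) that] refl by simp
      qed simp
      ultimately show "\<exists>T'\<le>Tm. t \<in> forward_interval T' \<and> sol T' w" by blast
    qed
    moreover have Un: "\<Union>\<C> = graph Tm w"
    proof (intro equalityI subsetI)
      fix p assume p: "p \<in> \<Union>\<C>"
      then obtain G where "G \<in> \<C>" "p \<in> G" by blast
      then obtain T v where v: "graph T v \<in> \<C>" "p \<in> graph T v" "0 < T" "sol T v"
        using memb by blast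
      then have "T \<le> Tm" unfolding Tm_def \<T>_def by (intro Sup_upper) blast
      moreover have "fst p \<in> forward_interval T" using v(2) by (auto simp: graph_def)
      ultimately have "fst p \<in> forward_interval Tm"
        using forward_interval_mono by blast
      moreover have "snd p = w (fst p)" using w[of "fst p" "snd p"] p by simp
      ultimately show "p \<in> graph Tm w"
        unfolding graph_def by (intro image_eqI[of _ _ "fst p"]) (auto simp: prod_eq_iff)
    next
      fix p assume "p \<in> graph Tm w"
      then have p: "fst p \<in> forward_interval Tm" "snd p = w (fst p)" by (auto simp: graph_def)
      then have "ereal (fst p) < Sup \<T>" "0 \<le> fst p" by (auto simp: forward_interval_def Tm_def)
      then obtain T where "T \<in> \<T>" "ereal (fst p) < T" by (auto simp: less_Sup_iff)
      then obtain v where v: "graph T v \<in> \<C>" by (auto simp: \<T>_def)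
      have T: "fst p \<in> forward_interval T"
        using \<open>ereal (fst p) < T\<close> \<open>0 \<le> fst p\<close> by (simp add: forward_interval_def)
      have "(fst p, snd p) \<in> graph T v" using agree[OF v T] T p(2) by (simp add: graph_iff)
      then show "p \<in> \<Union>\<C>" using v by auto
    qed
    moreover have "0 < Tm"
    proof -
      obtain G where "G \<in> \<C>" using ne by blast
      then obtain T v where "G = graph T v" "0 < T" "sol T v" using memb by blast
      then have "T \<le> Tm" unfolding Tm_def \<T>_def using \<open>G \<in> \<C>\<close> by (intro Sup_upper) blast
      then show ?thesis using \<open>0 < T\<close> by order
    qed
    moreover have "graph T0 u \<subseteq> \<Union>\<C>"
      using ne memb by blast
    ultimately show "\<Union>\<C> \<in> \<A>" unfolding \<A>_def Un by blast
  qed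
  then obtain G where G: "G \<in> \<A>" and max: "\<And>X. X \<in> \<A> \<Longrightarrow> G \<subseteq> X \<Longrightarrow> X = G"
    by blast
  obtain T v where G_eq: "G = graph T v" and T: "0 < T" and v: "sol T v" and "graph T0 u \<subseteq> G"
    using G unfolding \<A>_def by blast
  then have ext: "graph T0 u \<subseteq> graph T v" by simp
  have agree: "t \<in> forward_interval T \<and> v t = u t" if "t \<in> forward_interval T0" for t
  proof -
    have "(t, u t) \<in> graph T0 u" using that by (simp add: graph_iff)
    then have "(t, u t) \<in> graph T v" using ext by blast
    then show ?thesis by (simp add: graph_iff)
  qed
  have "T0 \<le> T"
    using agree by (intro forward_interval_subset_imp_le[OF T0]) blast
  moreover have "maximal_trajectory eq sol T v"
    unfolding maximal_trajectory_def
  proof (intro conjI notI T v)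
    assume "\<exists>T' w. T < T' \<and> sol T' w \<and> (\<forall>t\<in>forward_interval T. eq (w t) (v t))"
    then obtain T' w where w: "T < T'" "sol T' w" "\<And>t. t \<in> forward_interval T \<Longrightarrow> eq (w t) (v t)" by blast
    \<comment> \<open>A competitor \<open>w\<close> agrees with \<open>v\<close> only up to
      \<open>eq\<close>. Overwriting it by \<open>v\<close> on the common interval makes its graph a
      genuine superset, and \<open>restrict\<close> keeps it a solution.\<close>
    define w' where "w' t = (if t \<in> forward_interval T then v t else w t)" for t
    have "sol T' w'"
      using w(2) by (rule restrict) (auto simp: w'_def refl w(3))
    moreover have sub: "graph T v \<subseteq> graph T' w'"
    proof -
      have "graph T v = graph T w'" by (simp add: graph_def w'_def)
      also have "\<dots> \<subseteq> graph T' w'"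
        unfolding graph_def using forward_interval_mono[OF less_imp_le[OF w(1)]] by (rule image_mono)
      finally show ?thesis .
    qed
    moreover have "0 < T'" using T w(1) by order
    moreover have "graph T0 u \<subseteq> graph T' w'" using ext sub by order
    ultimately have "graph T' w' \<in> \<A>"
      unfolding \<A>_def by blast
    then have "graph T' w' = graph T v" using max[of "graph T' w'"] sub by (simp add: G_eq)
    then have "fst ` graph T' w' = fst ` graph T v" by simp
    then have "forward_interval T' = forward_interval T"
      by (simp add: graph_def image_image)
    then have "T' \<le> T"
      using T w(1) by (intro forward_interval_subset_imp_le) auto
    then show False using w(1) by simp
  qed
  ultimately show ?thesis
    using agree by blast
qed

section \<open>Ordinary differential equations\<close>

text \<open>The integral form matches the variation of constants formula and is the one a fixed
  point argument produces.\<close>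

lemma ode_solution_iff_integral:
  fixes F :: "'a::euclidean_space \<Rightarrow> 'a"
  assumes F: "continuous_on UNIV F"
  shows "ode_solution F T u \<longleftrightarrow> continuous_on (forward_interval T) u \<and>
    (\<forall>t\<in>forward_interval T. u t = u 0 + integral {0..t} (\<lambda>s. F (u s)))"
proof (intro iffI conjI ballI)
  assume u: "ode_solution F T u"
  then show "continuous_on (forward_interval T) u"
    unfolding ode_solution_def continuous_on_eq_continuous_within
    by (intro ballI) (rule has_vector_derivative_continuous, blast)
  fix t assume t: "t \<in> forward_interval T"
  have "((\<lambda>s. F (u s)) has_integral u t - u 0) {0..t}"
  proof (rule fundamental_theorem_of_calculus)
    show "0 \<le> t" using t by (simp add: forward_interval_def)
    show "(u has_vector_derivative F (u s)) (at s within {0..t})" if "s \<in> {0..t}" for s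
    proof (rule has_vector_derivative_within_subset[OF _ forward_interval_Icc[OF t]])
      show "(u has_vector_derivative F (u s)) (at s within forward_interval T)"
        using u that forward_interval_Icc[OF t] unfolding ode_solution_def by blast
    qed
  qed
  then show "u t = u 0 + integral {0..t} (\<lambda>s. F (u s))"
    by (simp add: integral_unique)
next
  assume u: "continuous_on (forward_interval T) u \<and>
    (\<forall>t\<in>forward_interval T. u t = u 0 + integral {0..t} (\<lambda>s. F (u s)))"
  show "ode_solution F T u"
    unfolding ode_solution_def
  proof
    fix t assume t: "t \<in> forward_interval T"
    then have "ereal t < T" "0 \<le> t" by (auto simp: forward_interval_def)
    \<comment> \<open>A time \<open>b\<close> strictly between \<open>t\<close> and \<open>T\<close>
      puts \<open>t\<close> into a compact interval, where the fundamental theorem applies, without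
      making it the right end point.\<close>
    then obtain b where b: "ereal t < ereal b" "ereal b < T" using ereal_dense2 by blast
    then have "b \<in> forward_interval T" using \<open>0 \<le> t\<close> by (simp add: forward_interval_def)
    note sub = forward_interval_Icc[OF this]
    have tb: "t \<in> {0..b}" using b \<open>0 \<le> t\<close> by simp
    have "continuous_on {0..b} (\<lambda>s. F (u s))"
      using continuous_on_compose2[OF F continuous_on_subset[OF conjunct1[OF u] sub]] by simp
    from has_vector_derivative_add[OF has_vector_derivative_const integral_has_vector_derivative[OF this tb]]
    have "((\<lambda>s. u 0 + integral {0..s} (\<lambda>s. F (u s))) has_vector_derivative F (u t)) (at t within {0..b})"
      by simp
    then have "(u has_vector_derivative F (u t)) (at t within {0..b})"
    proof (rule has_vector_derivative_transform[OF tb, rotated])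
      show "u s = u 0 + integral {0..s} (\<lambda>s. F (u s))" if "s \<in> {0..b}" for s
        using u sub that by blast
    qed
    moreover have "at t within {0..b} = at t within forward_interval T"
    proof (rule at_within_nhd)
      show "{0..b} \<inter> {..<b} - {t} = forward_interval T \<inter> {..<b} - {t}"
        using sub by (auto simp: forward_interval_def)
    qed (use b in auto)
    ultimately show "(u has_vector_derivative F (u t)) (at t within forward_interval T)" by simp
  qed
qed

text \<open>Picard's operator is a contraction with factor \<open>L * \<tau>\<close> on bounded
  continuous functions; the bound \<open>M\<close> keeps its values bounded.\<close>

lemma lipschitz_integral_equation_solution:
  fixes G :: "'a::euclidean_space \<Rightarrow> 'a"
  assumes L: "L-lipschitz_on UNIV G" and M: "\<And>x. norm (G x) \<le> M" and "\<tau> \<ge> 0" "L * \<tau> < 1"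
  obtains u where "continuous_on UNIV u"
    "\<And>t. t \<in> {0..\<tau>} \<Longrightarrow> u t = u0 + integral {0..t} (\<lambda>s. G (u s))"
proof -
  have "L \<ge> 0" using L by (rule lipschitz_on_nonneg)
  have Gc: "continuous_on UNIV G" using L by (rule lipschitz_on_continuous_on)
  have Gu: "continuous_on A (\<lambda>s. G (apply_bcontfun w s))" for A and w :: "real \<Rightarrow>\<^sub>C 'a"
    by (rule continuous_on_compose2[OF Gc continuous_on_apply_bcontfun]) simp
  \<comment> \<open>Freezing the upper limit outside \<open>[0, \<tau>]\<close> makes
    \<open>\<Phi> w\<close> a bounded continuous function on the whole line, as the type of
    \<open>w\<close> requires.\<close>
  define clamp where "clamp t = max 0 (min t \<tau>)" for t
  have clamp: "clamp t \<in> {0..\<tau>}" for t using \<open>\<tau> \<ge> 0\<close> by (auto simp: clamp_def)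
  define \<Phi> where "\<Phi> w t = u0 + integral {0..clamp t} (\<lambda>s. G (apply_bcontfun w s))" for w t
  have \<Phi>: "\<Phi> w \<in> bcontfun" for w
  proof (rule bcontfun_normI)
    have "continuous_on {0..\<tau>} (\<lambda>t. integral {0..t} (\<lambda>s. G (apply_bcontfun w s)))"
      by (intro indefinite_integral_continuous_1 integrable_continuous_real Gu)
    moreover have "continuous_on UNIV clamp"
      unfolding clamp_def by (intro continuous_intros)
    ultimately have "continuous_on UNIV (\<lambda>t. integral {0..clamp t} (\<lambda>s. G (apply_bcontfun w s)))"
      by (rule continuous_on_compose2) (use clamp in auto)
    then show "continuous_on UNIV (\<Phi> w)"
      unfolding \<Phi>_def by (intro continuous_on_add continuous_on_const)
    fix t
    have "norm (integral {0..clamp t} (\<lambda>s. G (apply_bcontfun w s))) \<le> M * (clamp t - 0)"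
      using clamp[of t] by (intro integral_bound Gu M) auto
    also have "\<dots> \<le> M * \<tau>"
      using clamp[of t] order_trans[OF norm_ge_zero M[of 0]] by (intro mult_left_mono) auto
    finally show "norm (\<Phi> w t) \<le> norm u0 + M * \<tau>"
      unfolding \<Phi>_def by (intro norm_triangle_le) simp
  qed
  have "\<exists>!w. Bcontfun (\<Phi> w) = w"
  proof (rule banach_fix_type)
    show "0 \<le> L * \<tau>" using \<open>L \<ge> 0\<close> \<open>\<tau> \<ge> 0\<close> by simp
    show "\<forall>v w. dist (Bcontfun (\<Phi> v)) (Bcontfun (\<Phi> w)) \<le> L * \<tau> * dist v w"
    proof (intro allI dist_bound)
      fix v w t
      have "\<Phi> v t - \<Phi> w t =
          integral {0..clamp t} (\<lambda>s. G (apply_bcontfun v s) - G (apply_bcontfun w s))"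
        unfolding \<Phi>_def by (subst integral_diff) (auto intro!: integrable_continuous_real Gu)
      also have "norm \<dots> \<le> (L * dist v w) * (clamp t - 0)"
      proof (rule integral_bound)
        fix s
        have "dist (G (apply_bcontfun v s)) (G (apply_bcontfun w s))
            \<le> L * dist (apply_bcontfun v s) (apply_bcontfun w s)"
          using L by (rule lipschitz_onD) auto
        also have "\<dots> \<le> L * dist v w"
          using \<open>L \<ge> 0\<close> by (intro mult_left_mono dist_bounded)
        finally show "norm (G (apply_bcontfun v s) - G (apply_bcontfun w s)) \<le> L * dist v w"
          by (simp add: dist_norm)
      qed (use clamp[of t] in \<open>auto intro!: continuous_on_diff Gu\<close>)
      also have "\<dots> \<le> (L * dist v w) * \<tau>"
        using clamp[of t] \<open>L \<ge> 0\<close> by (intro mult_left_mono) auto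
      finally show "dist (apply_bcontfun (Bcontfun (\<Phi> v)) t) (apply_bcontfun (Bcontfun (\<Phi> w)) t)
          \<le> L * \<tau> * dist v w"
        by (simp add: Bcontfun_inverse[OF \<Phi>] dist_norm mult_ac)
    qed
  qed (use assms in auto)
  then obtain w where "Bcontfun (\<Phi> w) = w" by blast
  then have w: "apply_bcontfun w t = \<Phi> w t" for t
    by (metis Bcontfun_inverse \<Phi>)
  show ?thesis
  proof (rule that)
    show "continuous_on UNIV (apply_bcontfun w)" by (rule continuous_on_apply_bcontfun)
    show "apply_bcontfun w t = u0 + integral {0..t} (\<lambda>s. G (apply_bcontfun w s))" if "t \<in> {0..\<tau>}" for t
      using that by (subst w) (simp add: \<Phi>_def clamp_def)
  qed
qed

text \<open>Precomposing \<open>F\<close> with the nearest-point map of a closed ball, which is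
  1-Lipschitz, gives a bounded, globally Lipschitz \<open>G\<close>. Up to time
  \<open>\<tau>\<close> the solution for \<open>G\<close> has not left the ball, and there
  \<open>G\<close> equals \<open>F\<close>.\<close>

lemma ode_local_existence:
  fixes F :: "'a::euclidean_space \<Rightarrow> 'a"
  assumes F: "locally_lipschitz F"
  obtains \<tau> u where "\<tau> > 0" "ode_solution F (ereal \<tau>) u" "u 0 = u0"
proof -
  obtain r L where r: "r > 0" and L: "L-lipschitz_on (ball u0 r) F"
    using F unfolding locally_lipschitz_def by blast
  define B where "B = cball u0 (r / 2)"
  have B: "convex B" "closed B" "B \<noteq> {}" using r by (auto simp: B_def)
  have LB: "L-lipschitz_on B F"
    using L by (rule lipschitz_on_subset) (use r in \<open>auto simp: B_def\<close>)
  have "L \<ge> 0" using L by (rule lipschitz_on_nonneg)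
  define G where "G x = F (closest_point B x)" for x
  have "1-lipschitz_on UNIV (closest_point B)"
    using closest_point_lipschitz[OF B] by (intro lipschitz_onI) auto
  moreover have "L-lipschitz_on (closest_point B ` UNIV) F"
    using LB by (rule lipschitz_on_subset) (use closest_point_in_set[OF B(2,3)] in auto)
  ultimately have LG: "L-lipschitz_on UNIV G"
    using lipschitz_on_compose[of 1 UNIV "closest_point B" L F] by (simp add: G_def[abs_def] comp_def)
  have G_eq: "G x = F x" if "x \<in> B" for x
    using that by (simp add: G_def closest_point_self)
  define M where "M = norm (F u0) + L * r"
  have M: "norm (G x) \<le> M" for x
  proof -
    have y: "closest_point B x \<in> B" by (rule closest_point_in_set[OF B(2,3)])
    then have "norm (G x - F u0) \<le> L * norm (closest_point B x - u0)"
      unfolding G_def using r by (intro lipschitz_on_normD[OF LB]) (auto simp: B_def)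
    also have "\<dots> \<le> L * r"
      using y r \<open>L \<ge> 0\<close> by (intro mult_left_mono) (auto simp: B_def dist_norm norm_minus_commute)
    finally show ?thesis
      using norm_triangle_sub[of "G x" "F u0"] by (simp add: M_def)
  qed
  have "M \<ge> 0" using r \<open>L \<ge> 0\<close> by (simp add: M_def)
  \<comment> \<open>The first bound gives \<open>L * \<tau> < 1\<close> for the contraction, the
    second \<open>M * \<tau> \<le> r / 2\<close> for staying in the ball. The summands 1 keep the
    denominators positive if \<open>L\<close> or \<open>M\<close> is 0.\<close>
  define \<tau> where "\<tau> = min (1 / (2 * (L + 1))) (r / (2 * (M + 1)))"
  have \<tau>: "\<tau> > 0" using r \<open>L \<ge> 0\<close> \<open>M \<ge> 0\<close> by (simp add: \<tau>_def)
  have "L * \<tau> \<le> L * (1 / (2 * (L + 1)))"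
    using \<open>L \<ge> 0\<close> by (intro mult_left_mono) (auto simp: \<tau>_def)
  also have "\<dots> < 1" using \<open>L \<ge> 0\<close> by (simp add: field_simps)
  finally have "L * \<tau> < 1" .
  have "M * \<tau> \<le> M * (r / (2 * (M + 1)))"
    using \<open>M \<ge> 0\<close> by (intro mult_left_mono) (auto simp: \<tau>_def)
  also have "\<dots> \<le> r / 2" using \<open>M \<ge> 0\<close> r by (simp add: field_simps)
  finally have M\<tau>: "M * \<tau> \<le> r / 2" .
  obtain u where uc: "continuous_on UNIV u"
    and u: "\<And>t. t \<in> {0..\<tau>} \<Longrightarrow> u t = u0 + integral {0..t} (\<lambda>s. G (u s))"
    using lipschitz_integral_equation_solution[OF LG M less_imp_le[OF \<tau>] \<open>L * \<tau> < 1\<close>] by blast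
  have "u 0 = u0" using u[of 0] \<tau> by simp
  have uB: "u t \<in> B" if t: "t \<in> {0..\<tau>}" for t
  proof -
    have "continuous_on {0..t} (\<lambda>s. G (u s))"
      using lipschitz_on_continuous_on[OF LG] continuous_on_subset[OF uc]
      by (rule continuous_on_compose2) auto
    then have "norm (integral {0..t} (\<lambda>s. G (u s))) \<le> M * (t - 0)"
      using t M by (intro integral_bound) auto
    also have "\<dots> \<le> M * \<tau>" using t \<open>M \<ge> 0\<close> by (intro mult_left_mono) auto
    finally show ?thesis using u[OF t] M\<tau> by (simp add: B_def dist_norm)
  qed
  have "ode_solution F (ereal \<tau>) u"
    unfolding ode_solution_iff_integral[OF locally_lipschitz_continuous[OF F]]
  proof (intro conjI ballI)
    show "continuous_on (forward_interval (ereal \<tau>)) u"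
      using uc continuous_on_subset by blast
    fix t assume "t \<in> forward_interval (ereal \<tau>)"
    then have t: "t \<in> {0..\<tau>}" by (simp add: forward_interval_def)
    have "integral {0..t} (\<lambda>s. G (u s)) = integral {0..t} (\<lambda>s. F (u s))"
      using t uB G_eq by (intro integral_cong) auto
    then show "u t = u 0 + integral {0..t} (\<lambda>s. F (u s))"
      using u[OF t] \<open>u 0 = u0\<close> by simp
  qed
  then show ?thesis using that \<tau> \<open>u 0 = u0\<close> by blast
qed

section \<open>Invariance of boxes\<close>

text \<open>
  The exponentially weighted excess of \<open>U\<close> over the box has supremum \<open>M\<close> with \<open>M \<le> M / 2\<close>.
\<close>

lemma mild_solution_stays_in_box:
  fixes F :: "real^'n \<Rightarrow> real^'n" and \<alpha> \<beta> :: "real^'n"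
    and S :: "'n \<Rightarrow> real \<Rightarrow> ('a::euclidean_space \<Rightarrow> real) \<Rightarrow> 'a \<Rightarrow> real"
  assumes S: "\<And>i. markov_semigroup K (S i)" and F: "locally_lipschitz F"
    and le: "\<And>j. \<alpha> $ j \<le> \<beta> $ j"
    and R: "R_inf F \<alpha> \<beta>" "R_sup F \<alpha> \<beta>"
    and U: "mild_solution K S F T U"
    and init: "\<And>x j. x \<in> K \<Longrightarrow> U 0 x $ j \<in> {\<alpha> $ j..\<beta> $ j}"
    and t: "t \<in> forward_interval T" and x: "x \<in> K"
  shows "U t x $ i \<in> {\<alpha> $ i..\<beta> $ i}"
proof -
  interpret Si: markov_semigroup K "S i" by (rule S)
  have "compact K" by (rule Si.compact_K)
  have "t \<ge> 0" using t by (simp add: forward_interval_def)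
  have Uc: "continuous_on ({0..t} \<times> K) (\<lambda>(s, x). U s x)"
    by (rule continuous_on_subset[OF mild_solution_joint_continuous[OF U]])
      (use forward_interval_Icc[OF t] in auto)
  \<comment> \<open>One compact set holding the values of \<open>U\<close> up to time
    \<open>t\<close> and their projections to the box, so that a single constant \<open>L\<close>
    compares \<open>F\<close> at both.\<close>
  define B where "B = (\<lambda>(s, x). U s x) ` ({0..t} \<times> K) \<union> {w. \<forall>j. w $ j \<in> {\<alpha> $ j..\<beta> $ j}}"
  have "{w. \<forall>j. w $ j \<in> {\<alpha> $ j..\<beta> $ j}} = cbox \<alpha> \<beta>"
    by (auto simp: mem_box_cart)
  then have "compact B"
    unfolding B_def using \<open>compact K\<close>
    by (auto intro!: compact_Un compact_continuous_image[OF Uc] compact_Times)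
  then obtain L where L: "L-lipschitz_on B F"
    using locally_lipschitz_compact[OF F] by blast
  have "L \<ge> 0" using L by (rule lipschitz_on_nonneg)
  have UB: "U s y \<in> B" if "s \<in> {0..t}" "y \<in> K" for s y
    unfolding B_def using that by (intro UnI1 image_eqI[of _ _ "(s, y)"]) auto
  \<comment> \<open>\<open>C\<close> is the constant of \<open>inward_field_estimate\<close>. The
    rate \<open>m\<close> is chosen so that \<open>2 * C \<le> L + m\<close>, hence
    \<open>C / (L + m) \<le> 1 / 2\<close>; the extra 1 keeps \<open>L + m\<close> positive when
    \<open>L = 0\<close>.\<close>
  define C where "C = L * (CARD('n) + 1)"
  define m where "m = 2 * C + 1"
  have "C \<ge> 0" "L + m > 0" using \<open>L \<ge> 0\<close> by (auto simp: C_def m_def add_nonneg_pos)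
  define e where "e s y j = exp (- m * s) * max (U s y $ j - \<beta> $ j) (\<alpha> $ j - U s y $ j)" for s y j
  have e_le: "e s y j \<le> k \<longleftrightarrow> U s y $ j - \<beta> $ j \<le> k * exp (m * s) \<and> \<alpha> $ j - U s y $ j \<le> k * exp (m * s)"
    for s y j k
  proof -
    have "exp (- m * s) * a \<le> k \<longleftrightarrow> a \<le> k * exp (m * s)" for a
      by (simp add: exp_minus inverse_eq_divide pos_divide_le_eq)
    then show ?thesis by (simp add: e_def)
  qed
  define W where "W = (\<lambda>((s, y), j). e s y j) ` (({0..t} \<times> K) \<times> UNIV)"
  \<comment> \<open>Inside the box the excess is negative. Inserting 0 gives
    \<open>M \<ge> 0\<close>, as the estimates of the field require.\<close>
  define M where "M = Sup (insert 0 W)"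
  have "bdd_above W"
  proof -
    have "compact ((\<lambda>(s, y). e s y j) ` ({0..t} \<times> K))" for j
    proof (rule compact_continuous_image)
      have "continuous_on ({0..t} \<times> K) (\<lambda>p. exp (- m * fst p) *
          max ((case p of (s, y) \<Rightarrow> U s y) $ j - \<beta> $ j) (\<alpha> $ j - (case p of (s, y) \<Rightarrow> U s y) $ j))"
        by (intro continuous_intros Uc)
      then show "continuous_on ({0..t} \<times> K) (\<lambda>(s, y). e s y j)"
        by (simp add: e_def case_prod_unfold)
    qed (intro compact_Times compact_Icc \<open>compact K\<close>)
    then have "bdd_above (\<Union>j\<in>(UNIV :: 'n set). (\<lambda>(s, y). e s y j) ` ({0..t} \<times> K))"
      by (simp add: bounded_imp_bdd_above compact_imp_bounded)
    moreover have "W \<subseteq> (\<Union>j\<in>UNIV. (\<lambda>(s, y). e s y j) ` ({0..t} \<times> K))"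
      unfolding W_def by auto
    ultimately show ?thesis by (rule bdd_above_mono)
  qed
  then have bdd: "bdd_above (insert 0 W)" by simp
  have "M \<ge> 0" unfolding M_def using bdd by (rule cSup_upper[rotated]) simp
  have excess: "U s y $ j - \<beta> $ j \<le> M * exp (m * s)" "\<alpha> $ j - U s y $ j \<le> M * exp (m * s)"
    if "s \<in> {0..t}" "y \<in> K" for s y j
  proof -
    have "e s y j \<in> insert 0 W"
      unfolding W_def using that by (intro insertI2 image_eqI[of _ _ "((s, y), j)"]) auto
    then have "e s y j \<le> M"
      unfolding M_def using bdd by (rule cSup_upper)
    then show "U s y $ j - \<beta> $ j \<le> M * exp (m * s)" "\<alpha> $ j - U s y $ j \<le> M * exp (m * s)"
      using e_le[of s y j M] by simp_all
  qed
  have Fc: "continuous_on ({0..t} \<times> K) (\<lambda>(s, x). F (U s x))"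
  proof -
    have "continuous_on ({0..t} \<times> K) (F \<circ> (\<lambda>(s, x). U s x))"
      using continuous_on_subset[OF locally_lipschitz_continuous[OF F] subset_UNIV]
      by (rule continuous_on_compose[OF Uc])
    then show ?thesis by (simp add: comp_def case_prod_unfold)
  qed
  \<comment> \<open>The upper faces are \<open>\<sigma> = 1\<close> with
    \<open>c = \<beta> $ i\<close>, the lower ones \<open>\<sigma> = -1\<close> with
    \<open>c = \<alpha> $ i\<close>. Since \<open>S i\<close> preserves constants,
    \<open>\<sigma> * (U - c)\<close> satisfies a mild formula with source
    \<open>\<sigma> * F\<close>.\<close>
  have signed: "\<sigma> * (U r x $ i - c) \<le> M / 2 * exp (m * r)"
    if r: "r \<in> {0..t}" and x: "x \<in> K"
      and init': "\<And>y. y \<in> K \<Longrightarrow> \<sigma> * (U 0 y $ i - c) \<le> 0"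
      and est: "\<And>v E. v \<in> B \<Longrightarrow> E \<ge> 0 \<Longrightarrow> (\<And>j. v $ j - \<beta> $ j \<le> E) \<Longrightarrow> (\<And>j. \<alpha> $ j - v $ j \<le> E) \<Longrightarrow>
        \<sigma> * F v $ i + L * (\<sigma> * (v $ i - c)) \<le> C * E"
    for \<sigma> c r x i
  proof -
    interpret Si: markov_semigroup K "S i" by (rule S)
    have sub: "{0..r} \<times> K \<subseteq> {0..t} \<times> K" using r by auto
    have uc: "continuous_on ({0..r} \<times> K) (\<lambda>(s, y). \<sigma> * (U s y $ i - c))"
      using continuous_on_subset[OF Uc sub] unfolding case_prod_unfold by (intro continuous_intros)
    have fc: "continuous_on ({0..r} \<times> K) (\<lambda>(s, y). \<sigma> * F (U s y) $ i)"
      using continuous_on_subset[OF Fc sub] unfolding case_prod_unfold by (intro continuous_intros)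
    have Fs: "continuous_on K (\<lambda>y. F (U s y) $ i)" if "s \<in> {0..t}" for s
      using continuous_on_slice1[OF Fc that] by (intro continuous_intros)
    have U0: "continuous_on K (\<lambda>y. U 0 y $ i)"
      using continuous_on_slice1[OF Uc, of 0] \<open>t \<ge> 0\<close> by (intro continuous_intros) auto
    have "\<sigma> * (U r x $ i - c) \<le> (C * M) / (L + m) * exp (m * r)"
    proof (rule Si.mild_upper_bound[OF _ uc fc _ init' _ \<open>L + m > 0\<close> _ x])
      show "\<sigma> * (U s y $ i - c) = S i s (\<lambda>y. \<sigma> * (U 0 y $ i - c)) y
          + integral {0..s} (\<lambda>\<tau>. S i (s - \<tau>) (\<lambda>y. \<sigma> * F (U \<tau> y) $ i) y)"
        if s: "s \<in> {0..r}" and y: "y \<in> K" for s y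
      proof -
        have "s \<in> forward_interval T" using s r forward_interval_Icc[OF t] by auto
        then have "U s y $ i = S i s (\<lambda>y. U 0 y $ i) y
            + integral {0..s} (\<lambda>\<tau>. S i (s - \<tau>) (\<lambda>y. F (U \<tau> y) $ i) y)"
          using U y unfolding mild_solution_def by blast
        moreover have "S i s (\<lambda>y. \<sigma> * (U 0 y $ i - c)) y = \<sigma> * S i s (\<lambda>y. U 0 y $ i) y - \<sigma> * c"
          using Si.S_affine[OF _ U0 y, of s \<sigma> "- (\<sigma> * c)"] s by (simp add: algebra_simps)
        moreover have "integral {0..s} (\<lambda>\<tau>. S i (s - \<tau>) (\<lambda>y. \<sigma> * F (U \<tau> y) $ i) y)
            = integral {0..s} (\<lambda>\<tau>. \<sigma> * S i (s - \<tau>) (\<lambda>y. F (U \<tau> y) $ i) y)"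
        proof (rule integral_cong)
          fix \<tau> assume "\<tau> \<in> {0..s}"
          then show "S i (s - \<tau>) (\<lambda>y. \<sigma> * F (U \<tau> y) $ i) y = \<sigma> * S i (s - \<tau>) (\<lambda>y. F (U \<tau> y) $ i) y"
            using Si.S_affine[OF _ Fs y, of "s - \<tau>" \<tau> \<sigma> 0] s r by simp
        qed
        ultimately show ?thesis by (simp add: algebra_simps)
      qed
      show "\<sigma> * F (U s y) $ i + L * (\<sigma> * (U s y $ i - c)) \<le> C * M * exp (m * s)"
        if "s \<in> {0..r}" "y \<in> K" for s y
        using est[OF UB, of s y "M * exp (m * s)"] excess[of s y] that r \<open>M \<ge> 0\<close> by (simp add: mult.assoc)
    qed (use r \<open>C \<ge> 0\<close> \<open>M \<ge> 0\<close> in auto)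
    also have "(C * M) / (L + m) \<le> M / 2"
    proof -
      have "C * M * 2 \<le> M * (L + m)"
        using mult_left_mono[of "2 * C" "L + m" M] \<open>L \<ge> 0\<close> \<open>C \<ge> 0\<close> \<open>M \<ge> 0\<close> by (simp add: m_def algebra_simps)
      then show ?thesis using \<open>L + m > 0\<close> by (simp add: field_simps)
    qed
    finally show ?thesis by simp
  qed
  have half: "U s y $ j - \<beta> $ j \<le> M / 2 * exp (m * s)" "\<alpha> $ j - U s y $ j \<le> M / 2 * exp (m * s)"
    if s: "s \<in> {0..t}" and y: "y \<in> K" for s y j
  proof -
    note est = inward_field_estimate[OF L _ _ le R]
    have "{w. \<forall>j. w $ j \<in> {\<alpha> $ j..\<beta> $ j}} \<subseteq> B" by (simp add: B_def)
    note est = est[OF this]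
    have "1 * (U s y $ j - \<beta> $ j) \<le> M / 2 * exp (m * s)"
    proof (rule signed[OF s y])
      show "1 * F v $ j + L * (1 * (v $ j - \<beta> $ j)) \<le> C * E"
        if "v \<in> B" "E \<ge> 0" "\<And>j. v $ j - \<beta> $ j \<le> E" "\<And>j. \<alpha> $ j - v $ j \<le> E" for v E
        using est(1)[OF that] by (simp add: C_def)
    qed (use init in auto)
    then show "U s y $ j - \<beta> $ j \<le> M / 2 * exp (m * s)" by simp
    have "(- 1) * (U s y $ j - \<alpha> $ j) \<le> M / 2 * exp (m * s)"
    proof (rule signed[OF s y])
      show "(- 1) * F v $ j + L * ((- 1) * (v $ j - \<alpha> $ j)) \<le> C * E"
        if "v \<in> B" "E \<ge> 0" "\<And>j. v $ j - \<beta> $ j \<le> E" "\<And>j. \<alpha> $ j - v $ j \<le> E" for v E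
        using est(2)[OF that, of j] by (simp add: C_def)
    qed (use init in auto)
    then show "\<alpha> $ j - U s y $ j \<le> M / 2 * exp (m * s)" by simp
  qed
  have "M \<le> M / 2"
    unfolding M_def
  proof (rule cSup_least, simp, fold M_def)
    fix w assume "w \<in> insert 0 W"
    then consider "w = 0" | s y j where "s \<in> {0..t}" "y \<in> K" "w = e s y j"
      unfolding W_def by auto
    then show "w \<le> M / 2"
    proof cases
      case 2
      then show ?thesis using half[of s y j] e_le[of s y j "M / 2"] by simp
    qed (use \<open>M \<ge> 0\<close> in simp)
  qed
  then have "M = 0" using \<open>M \<ge> 0\<close> by simp
  then show ?thesis
    using excess[of t x i] x \<open>t \<ge> 0\<close> by simp
qed

section \<open>Restricting, gluing and extending mild solutions; necessity of the conditions\<close>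

lemma zero_in_forward_interval: "0 < T \<Longrightarrow> 0 \<in> forward_interval T"
  by (simp add: forward_interval_def zero_ereal_def)

text \<open>This is the hypothesis \<open>restrict\<close> of
  \<open>maximal_trajectory_extension\<close>. Values off \<open>K\<close> may change because
  \<open>S_cong\<close> hides them from \<open>S i\<close>.\<close>

lemma mild_solution_restrict:
  assumes S: "\<And>i. markov_semigroup K (S i)" and F: "continuous_on UNIV F"
    and v: "mild_solution K S F T v" and "T' \<le> T"
    and eq: "\<And>t. t \<in> forward_interval T' \<Longrightarrow> equal_on K (v t) (w t)"
  shows "mild_solution K S F T' w"
  unfolding mild_solution_def
proof (intro conjI ballI allI)
  note sub = forward_interval_mono[OF \<open>T' \<le> T\<close>]
  have vw: "v t x = w t x" if "t \<in> forward_interval T'" "x \<in> K" for t x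
    using eq that unfolding equal_on_def by blast
  have vc: "continuous_on K (v t)" if "t \<in> forward_interval T'" for t
    using v that sub unfolding mild_solution_def by blast
  fix t assume t: "t \<in> forward_interval T'"
  show "continuous_on K (w t)"
    using vc[OF t] by (rule continuous_on_eq) (simp add: vw t)
  show "uniform_limit K w (w t) (at t within forward_interval T')"
  proof -
    have "uniform_limit K v (v t) (at t within forward_interval T)"
      using v t sub unfolding mild_solution_def by blast
    then have "uniform_limit K v (v t) (at t within forward_interval T')"
      unfolding at_within_forward_interval[OF t \<open>T' \<le> T\<close>] .
    moreover have ev: "\<forall>\<^sub>F s in at t within forward_interval T'. \<forall>x\<in>K. v s x = w s x"
      unfolding eventually_at_filter by (rule always_eventually) (auto simp: vw)
    ultimately show ?thesis
      using uniform_limit_cong[OF ev, where h = "v t" and i = "w t"] vw[OF t] by simp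
  qed
  fix i x assume x: "x \<in> K"
  interpret markov_semigroup K "S i" by (rule S)
  have Icc: "{0..t} \<subseteq> forward_interval T'" by (rule forward_interval_Icc[OF t])
  have t0: "0 \<le> t" using t by (simp add: forward_interval_def)
  have "v t x $ i = S i t (\<lambda>y. v 0 y $ i) x + integral {0..t} (\<lambda>s. S i (t - s) (\<lambda>y. F (v s y) $ i) x)"
    using v t x sub unfolding mild_solution_def by blast
  also have "v t x = w t x" using vw t x by blast
  also have "S i t (\<lambda>y. v 0 y $ i) x = S i t (\<lambda>y. w 0 y $ i) x"
  proof (rule S_cong[OF t0 _ _ x])
    have 0: "0 \<in> forward_interval T'" using Icc t0 by auto
    show "continuous_on K (\<lambda>y. v 0 y $ i)"
      using vc[OF 0] by (intro continuous_intros)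
    show "v 0 y $ i = w 0 y $ i" if "y \<in> K" for y using vw[OF 0 that] by simp
  qed
  also have "integral {0..t} (\<lambda>s. S i (t - s) (\<lambda>y. F (v s y) $ i) x)
      = integral {0..t} (\<lambda>s. S i (t - s) (\<lambda>y. F (w s y) $ i) x)"
  proof (rule integral_cong)
    fix s assume s: "s \<in> {0..t}"
    then have s': "s \<in> forward_interval T'" using Icc by blast
    show "S i (t - s) (\<lambda>y. F (v s y) $ i) x = S i (t - s) (\<lambda>y. F (w s y) $ i) x"
    proof (rule S_cong[OF _ _ _ x])
      have "continuous_on K (\<lambda>y. F (v s y))"
        by (rule continuous_on_compose2[OF F vc[OF s']]) simp
      then show "continuous_on K (\<lambda>y. F (v s y) $ i)"
        by (intro continuous_intros)
    qed (use s vw[OF s'] in simp_all)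
  qed
  finally show "w t x $ i = S i t (\<lambda>y. w 0 y $ i) x
      + integral {0..t} (\<lambda>s. S i (t - s) (\<lambda>y. F (w s y) $ i) x)" .
qed

text \<open>This is the hypothesis \<open>union\<close> of
  \<open>maximal_trajectory_extension\<close>. Each clause at time \<open>t\<close> sees only
  \<open>[0, t]\<close> and times near \<open>t\<close>.\<close>

lemma mild_solution_union:
  assumes ex: "\<And>t. t \<in> forward_interval T \<Longrightarrow>
      \<exists>T'\<le>T. t \<in> forward_interval T' \<and> mild_solution K S F T' v"
  shows "mild_solution K S F T v"
  unfolding mild_solution_def
proof (intro conjI ballI)
  fix t assume "t \<in> forward_interval T"
  from ex[OF this] obtain T' where T': "T' \<le> T" "t \<in> forward_interval T'" "mild_solution K S F T' v"
    by blast
  show "continuous_on K (v t)" using T'(2,3) unfolding mild_solution_def by blast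
  show "uniform_limit K v (v t) (at t within forward_interval T)"
    unfolding at_within_forward_interval[OF T'(2,1)]
    using T'(2,3) unfolding mild_solution_def by blast
  show "\<forall>i. \<forall>x\<in>K. v t x $ i = S i t (\<lambda>y. v 0 y $ i) x
      + integral {0..t} (\<lambda>s. S i (t - s) (\<lambda>y. F (v s y) $ i) x)"
    using T'(2,3) unfolding mild_solution_def by blast
qed

lemma ode_solution_component:
  fixes F :: "real^'n \<Rightarrow> real^'n"
  assumes "continuous_on UNIV F" "continuous_on (forward_interval T) u" "t \<in> forward_interval T"
  shows "u t = u 0 + integral {0..t} (\<lambda>s. F (u s)) \<longleftrightarrow>
    (\<forall>i. u t $ i = u 0 $ i + integral {0..t} (\<lambda>s. F (u s) $ i))"
proof -
  have "(\<lambda>s. F (u s)) integrable_on {0..t}"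
    using assms forward_interval_Icc[OF assms(3)]
    by (intro integrable_continuous_real continuous_on_compose2[OF assms(1) continuous_on_subset[OF assms(2)]])
      (simp, simp)
  then show ?thesis
    by (simp add: vec_eq_iff)
qed

lemma mild_solution_spatially_constant:
  fixes F :: "real^'n \<Rightarrow> real^'n"
  assumes S: "\<And>i. markov_semigroup K (S i)" and F: "continuous_on UNIV F"
    and u: "ode_solution F T u"
  shows "mild_solution K S F T (\<lambda>t _. u t)"
  unfolding mild_solution_def
proof (intro conjI ballI allI)
  have uc: "continuous_on (forward_interval T) u"
    and ui: "\<And>t. t \<in> forward_interval T \<Longrightarrow> u t = u 0 + integral {0..t} (\<lambda>s. F (u s))"
    using u unfolding ode_solution_iff_integral[OF F] by blast+
  fix t assume t: "t \<in> forward_interval T"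
  show "continuous_on K (\<lambda>_. u t)" by simp
  show "uniform_limit K (\<lambda>t _. u t) (\<lambda>_. u t) (at t within forward_interval T)"
    using uc t unfolding continuous_on_def uniform_limit_iff tendsto_iff
    by (auto elim!: eventually_mono)
  fix i x assume x: "x \<in> K"
  interpret markov_semigroup K "S i" by (rule S)
  have "integral {0..t} (\<lambda>s. S i (t - s) (\<lambda>y. F (u s) $ i) x) = integral {0..t} (\<lambda>s. F (u s) $ i)"
    using x by (intro integral_cong S_const) auto
  moreover have "S i t (\<lambda>_. u 0 $ i) x = u 0 $ i"
    using t x by (intro S_const) (auto simp: forward_interval_def)
  ultimately show "u t $ i = S i t (\<lambda>y. u 0 $ i) x
      + integral {0..t} (\<lambda>s. S i (t - s) (\<lambda>y. F (u s) $ i) x)"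
    using ui[OF t] unfolding ode_solution_component[OF F uc t] by simp
qed

abbreviation (input) box_states :: "'a set \<Rightarrow> real^'n \<Rightarrow> real^'n \<Rightarrow> ('a::topological_space \<Rightarrow> real^'n) set" where
  "box_states K \<alpha> \<beta> \<equiv>
     {U. continuous_on K U \<and> (\<forall>x\<in>K. \<forall>j. U x $ j \<in> {\<alpha> $ j..\<beta> $ j})}"

text \<open>The spatially constant solution need not be maximal, so it is first extended to a
  maximal mild trajectory. Only the agreement before \<open>T\<close> is used; later values of the
  extension are left open.\<close>

lemma invariant_imp_ode_stays_in_box:
  fixes F :: "real^'n \<Rightarrow> real^'n" and K :: "'b::euclidean_space set"
  assumes S: "\<And>i. markov_semigroup K (S i)" and F: "locally_lipschitz F"
    and inv: "invariant_under (equal_on K) (mild_solution K S F) (box_states K \<alpha> \<beta>)"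
    and u: "ode_solution F T u"
    and init: "\<And>j. u 0 $ j \<in> {\<alpha> $ j..\<beta> $ j}" and t: "t \<in> forward_interval T"
  shows "u t $ j \<in> {\<alpha> $ j..\<beta> $ j}"
proof -
  interpret Sj: markov_semigroup K "S j" by (rule S)
  obtain x where x: "x \<in> K" using Sj.K_ne by blast
  note Fc = locally_lipschitz_continuous[OF F]
  have "0 < T" using t le_less_trans[of 0 "ereal t" T] by (simp add: forward_interval_def)
  have const: "mild_solution K S F T (\<lambda>t _. u t)"
    using S Fc u by (rule mild_solution_spatially_constant)
  have restrict: "mild_solution K S F T' w"
    if "mild_solution K S F T v" "T' \<le> T" "\<And>t. t \<in> forward_interval T' \<Longrightarrow> equal_on K (v t) (w t)"
    for T v T' w
    using that by (rule mild_solution_restrict[OF S Fc])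
  have union: "mild_solution K S F T v"
    if "\<And>t. t \<in> forward_interval T \<Longrightarrow> \<exists>T'\<le>T. t \<in> forward_interval T' \<and> mild_solution K S F T' v"
    for T v
    using that by (rule mild_solution_union)
  have refl: "equal_on K f f" for f :: "'b \<Rightarrow> real^'n"
    by (simp add: equal_on_def)
  have "\<exists>T' v. T \<le> T' \<and> maximal_trajectory (equal_on K) (mild_solution K S F) T' v \<and>
      (\<forall>t\<in>forward_interval T. v t = (\<lambda>_. u t))"
    by (rule maximal_trajectory_extension[where sol = "mild_solution K S F" and eq = "equal_on K"])
      (fact restrict, fact union, fact refl, fact, fact const)
  then obtain T' v where T': "T \<le> T'"
    and v: "maximal_trajectory (equal_on K) (mild_solution K S F) T' v"
    and eq: "\<And>t. t \<in> forward_interval T \<Longrightarrow> v t = (\<lambda>_. u t)"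
    by blast
  have "v 0 \<in> box_states K \<alpha> \<beta>"
    using eq[OF zero_in_forward_interval[OF \<open>0 < T\<close>]] init by simp
  moreover have "t \<in> forward_interval T'"
    using t forward_interval_mono[OF T'] by blast
  ultimately have "v t \<in> box_states K \<alpha> \<beta>"
    using inv v unfolding invariant_under_def by blast
  then show ?thesis using eq[OF t] x by auto
qed

text \<open>At a point \<open>w\<close> of a face, \<open>\<sigma> * w $ i\<close> is the maximum of
  \<open>\<sigma> * z\<close> over \<open>[\<alpha> $ i, \<beta> $ i]\<close>. A positive
  \<open>\<sigma> * F w $ i\<close> would push \<open>\<sigma> * u $ i\<close> above this maximum at
  small positive times. The sign is -1 for the lower and 1 for the upper faces.\<close>

lemma invariant_imp_inward:
  fixes F :: "real^'n \<Rightarrow> real^'n"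
  assumes S: "\<And>i. markov_semigroup K (S i)" and F: "locally_lipschitz F"
    and le: "\<And>j. \<alpha> $ j \<le> \<beta> $ j"
    and inv: "invariant_under (equal_on K) (mild_solution K S F) (box_states K \<alpha> \<beta>)"
  shows "R_inf F \<alpha> \<beta> \<and> R_sup F \<alpha> \<beta>"
proof -
  have main: "\<sigma> * F w $ i \<le> 0"
    if w: "\<And>j. w $ j \<in> {\<alpha> $ j..\<beta> $ j}"
      and face: "\<And>z. z \<in> {\<alpha> $ i..\<beta> $ i} \<Longrightarrow> \<sigma> * z \<le> \<sigma> * w $ i" for w i \<sigma>
  proof (rule ccontr)
    assume pos: "\<not> \<sigma> * F w $ i \<le> 0"
    obtain \<tau> u where "\<tau> > 0" and u: "ode_solution F (ereal \<tau>) u" and u0: "u 0 = w"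
      using ode_local_existence[OF F] by blast
    have "0 \<in> forward_interval (ereal \<tau>)"
      using \<open>\<tau> > 0\<close> by (intro zero_in_forward_interval) (simp add: zero_ereal_def)
    then have "(u has_vector_derivative F w) (at 0 within forward_interval (ereal \<tau>))"
      using u u0 unfolding ode_solution_def by blast
    then have "((\<lambda>t. u t $ i) has_vector_derivative F w $ i) (at 0 within forward_interval (ereal \<tau>))"
      by (rule bounded_linear.has_vector_derivative[OF bounded_linear_vec_nth])
    then have "((\<lambda>t. \<sigma> * u t $ i) has_real_derivative \<sigma> * F w $ i) (at 0 within forward_interval (ereal \<tau>))"
      by (intro DERIV_cmult) (simp add: has_real_derivative_iff_has_vector_derivative)
    then obtain d where "d > 0"
      and d: "\<And>h. h > 0 \<Longrightarrow> 0 + h \<in> forward_interval (ereal \<tau>) \<Longrightarrow> h < d \<Longrightarrow> \<sigma> * u 0 $ i < \<sigma> * u (0 + h) $ i"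
      using has_real_derivative_pos_inc_right[of "\<lambda>t. \<sigma> * u t $ i"] pos not_le by blast
    define h where "h = min d \<tau> / 2"
    have h: "0 < h" "h < d" "h \<in> forward_interval (ereal \<tau>)"
      using \<open>d > 0\<close> \<open>\<tau> > 0\<close> by (auto simp: h_def forward_interval_def min_def)
    have "u h $ i \<in> {\<alpha> $ i..\<beta> $ i}"
      using w u0 by (intro invariant_imp_ode_stays_in_box[OF S F inv u _ h(3)]) auto
    then show False using face[of "u h $ i"] d[of h] h u0 by simp
  qed
  show ?thesis
    unfolding R_inf_def R_sup_def
  proof (intro conjI allI impI)
    fix i and u :: "real^'n" assume u: "\<forall>j. j \<noteq> i \<longrightarrow> u $ j \<in> {\<alpha> $ j..\<beta> $ j}"
    show "F (\<chi> j. if j = i then \<alpha> $ i else u $ j) $ i \<ge> 0"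
      using main[of "\<chi> j. if j = i then \<alpha> $ i else u $ j" i "-1"] u le[of i] by simp
    show "F (\<chi> j. if j = i then \<beta> $ i else u $ j) $ i \<le> 0"
      using main[of "\<chi> j. if j = i then \<beta> $ i else u $ j" i 1] u le[of i] by simp
  qed
qed

lemma box_invariant_iff:
  fixes F :: "real^'n \<Rightarrow> real^'n"
  assumes S: "\<And>i. markov_semigroup K (S i)" and F: "locally_lipschitz F"
    and le: "\<And>j. \<alpha> $ j \<le> \<beta> $ j"
  shows "invariant_under (equal_on K) (mild_solution K S F) (box_states K \<alpha> \<beta>)
    \<longleftrightarrow> R_inf F \<alpha> \<beta> \<and> R_sup F \<alpha> \<beta>"
proof
  assume R: "R_inf F \<alpha> \<beta> \<and> R_sup F \<alpha> \<beta>"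
  show "invariant_under (equal_on K) (mild_solution K S F) (box_states K \<alpha> \<beta>)"
    unfolding invariant_under_def
  proof (intro allI impI ballI)
    fix T U t assume "maximal_trajectory (equal_on K) (mild_solution K S F) T U"
      and 0: "U 0 \<in> box_states K \<alpha> \<beta>" and t: "t \<in> forward_interval T"
    then have U: "mild_solution K S F T U" by (simp add: maximal_trajectory_def)
    have "U t x $ j \<in> {\<alpha> $ j..\<beta> $ j}" if "x \<in> K" for x j
      using R 0 by (intro mild_solution_stays_in_box[OF S F le _ _ U _ t that]) auto
    moreover have "continuous_on K (U t)" using U t unfolding mild_solution_def by blast
    ultimately show "U t \<in> box_states K \<alpha> \<beta>" by blast
  qed
next
  assume "invariant_under (equal_on K) (mild_solution K S F) (box_states K \<alpha> \<beta>)"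
  then show "R_inf F \<alpha> \<beta> \<and> R_sup F \<alpha> \<beta>"
    by (rule invariant_imp_inward[OF S F le])
qed

section \<open>The one-point space: ordinary differential equations\<close>

lemma markov_semigroup_point: "markov_semigroup {0::real} (\<lambda>_ u. u)"
proof
  show "contraction_semigroup_C {0::real} (\<lambda>_ u. u)"
    unfolding contraction_semigroup_C_def by simp
qed auto

lemma mild_solution_point_iff:
  fixes F :: "real^'n \<Rightarrow> real^'n"
  assumes F: "continuous_on UNIV F"
  shows "mild_solution {0::real} (\<lambda>_ _ u. u) F T V \<longleftrightarrow> ode_solution F T (\<lambda>t. V t 0)"
proof -
  have "mild_solution {0::real} (\<lambda>_ _ u. u) F T V \<longleftrightarrow> continuous_on (forward_interval T) (\<lambda>t. V t 0) \<and>
      (\<forall>t\<in>forward_interval T. \<forall>i. V t 0 $ i = V 0 0 $ i + integral {0..t} (\<lambda>s. F (V s 0) $ i))"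
    by (simp add: mild_solution_def continuous_on_def[of "forward_interval T"])
  also have "\<dots> \<longleftrightarrow> ode_solution F T (\<lambda>t. V t 0)"
    unfolding ode_solution_iff_integral[OF F]
    using ode_solution_component[OF F, of T "\<lambda>t. V t 0"] by blast
  finally show ?thesis .
qed

text \<open>Many functions \<open>V t\<close> share the value at 0, but each trajectory of the
  differential equation lifts to one that is constant in space. This carries competing extensions
  over in both directions.\<close>

lemma maximal_trajectory_point_iff:
  fixes F :: "real^'n \<Rightarrow> real^'n"
  assumes F: "continuous_on UNIV F"
  shows "maximal_trajectory (equal_on {0}) (mild_solution {0::real} (\<lambda>_ _ u. u) F) T V \<longleftrightarrow>
    maximal_trajectory (=) (ode_solution F) T (\<lambda>t. V t 0)"
proof -
  have eq: "(\<exists>T' W. T < T' \<and> ode_solution F T' (\<lambda>t. W t 0) \<and> (\<forall>t\<in>forward_interval T. W t 0 = V t 0))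
     \<longleftrightarrow> (\<exists>T' v. T < T' \<and> ode_solution F T' v \<and> (\<forall>t\<in>forward_interval T. v t = V t 0))"
    (is "?l \<longleftrightarrow> ?r")
  proof
    assume ?r
    then obtain T' v where "T < T'" "ode_solution F T' v" "\<forall>t\<in>forward_interval T. v t = V t 0" by blast
    then show ?l by (intro exI[of _ T'] exI[of _ "\<lambda>t _. v t"]) simp
  qed blast
  have "equal_on {0} f g \<longleftrightarrow> f 0 = g 0" for f g :: "real \<Rightarrow> real^'n"
    by (simp add: equal_on_def)
  then show ?thesis
    by (simp only: maximal_trajectory_def mild_solution_point_iff[OF F] eq)
qed

lemma invariant_point_iff:
  fixes F :: "real^'n \<Rightarrow> real^'n"
  assumes F: "continuous_on UNIV F"
  shows "invariant_under (=) (ode_solution F) {u. \<forall>j. u $ j \<in> {\<alpha> $ j..\<beta> $ j}} \<longleftrightarrow>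
    invariant_under (equal_on {0}) (mild_solution {0::real} (\<lambda>_ _ u. u) F) (box_states {0} \<alpha> \<beta>)"
  (is "?l \<longleftrightarrow> ?r")
proof
  assume l: ?l
  show ?r
    unfolding invariant_under_def maximal_trajectory_point_iff[OF F]
  proof (intro allI impI)
    fix T and V :: "real \<Rightarrow> real \<Rightarrow> real^'n"
    assume "maximal_trajectory (=) (ode_solution F) T (\<lambda>t. V t 0)" "V 0 \<in> box_states {0} \<alpha> \<beta>"
    then show "\<forall>t\<in>forward_interval T. V t \<in> box_states {0} \<alpha> \<beta>"
      using l[unfolded invariant_under_def, rule_format, of T "\<lambda>t. V t 0"] by simp
  qed
next
  assume r: ?r
  show ?l
    unfolding invariant_under_def
  proof (intro allI impI)
    fix T u assume "maximal_trajectory (=) (ode_solution F) T u" "u 0 \<in> {u. \<forall>j. u $ j \<in> {\<alpha> $ j..\<beta> $ j}}"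
    then show "\<forall>t\<in>forward_interval T. u t \<in> {u. \<forall>j. u $ j \<in> {\<alpha> $ j..\<beta> $ j}}"
      using r[unfolded invariant_under_def maximal_trajectory_point_iff[OF F], rule_format, of T "\<lambda>t _. u t"]
      by simp
  qed
qed

section \<open>The Neumann semigroup is Markov\<close>

text \<open>Let \<open>s\<close> be the last time in \<open>[0, \<tau>]\<close> with
  \<open>\<phi> s \<le> \<epsilon> * s\<close>; it exists by continuity. If
  \<open>s < \<tau>\<close>, the hypothesis on right increments carries the inequality to some
  \<open>s + h\<close>, a contradiction. Then \<open>\<epsilon>\<close> tends to 0.\<close>

lemma nonpos_of_right_derivative_nonpos:
  fixes \<phi> :: "real \<Rightarrow> real"
  assumes cont: "continuous_on {0..\<tau>} \<phi>" and "\<tau> \<ge> 0" "\<phi> 0 \<le> 0"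
    and dini: "\<And>t \<epsilon>. t \<ge> 0 \<Longrightarrow> \<epsilon> > 0 \<Longrightarrow> \<exists>\<delta>>0. \<forall>h. 0 < h \<and> h < \<delta> \<longrightarrow> \<phi> (t + h) \<le> \<phi> t + \<epsilon> * h"
  shows "\<phi> \<tau> \<le> 0"
proof -
  have eps: "\<phi> \<tau> \<le> 0 + \<epsilon> * \<tau>" if "\<epsilon> > 0" for \<epsilon>
  proof -
    define A where "A = {0..\<tau>} \<inter> (\<lambda>t. \<phi> t - \<epsilon> * t) -` {..0}"
    have "closed A"
      unfolding A_def by (intro continuous_closed_preimage continuous_intros cont)
    moreover have "bounded A"
      by (rule bounded_subset[of "{0..\<tau>}"]) (auto simp: A_def)
    ultimately have "compact A" by (simp add: compact_eq_bounded_closed)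
    moreover have "0 \<in> A" using assms by (simp add: A_def)
    ultimately obtain s where s: "s \<in> A" "\<And>t. t \<in> A \<Longrightarrow> t \<le> s"
      using compact_attains_sup[of A] by blast
    have "s = \<tau>"
    proof (rule ccontr)
      assume "s \<noteq> \<tau>"
      then have "0 \<le> s" "s < \<tau>" using s(1) by (auto simp: A_def)
      obtain \<delta> where \<delta>: "\<delta> > 0" "\<And>h. 0 < h \<Longrightarrow> h < \<delta> \<Longrightarrow> \<phi> (s + h) \<le> \<phi> s + \<epsilon> * h"
        using dini[OF \<open>0 \<le> s\<close> \<open>\<epsilon> > 0\<close>] by blast
      define h where "h = min \<delta> (\<tau> - s) / 2"
      have h: "0 < h" "h < \<delta>" "s + h \<le> \<tau>"
        using \<open>\<delta> > 0\<close> \<open>s < \<tau>\<close> by (auto simp: h_def min_def field_simps)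
      have "s + h \<in> A"
        using \<delta>(2)[OF h(1,2)] s(1) h \<open>0 \<le> s\<close> by (simp add: A_def algebra_simps)
      then show False using s(2) h(1) by fastforce
    qed
    then show ?thesis using s(1) by (simp add: A_def)
  qed
  show ?thesis
  proof (cases "\<tau> = 0")
    case False
    show ?thesis
    proof (rule field_le_epsilon)
      fix e :: real assume "e > 0"
      then show "\<phi> \<tau> \<le> 0 + e"
        using eps[of "e / \<tau>"] False \<open>\<tau> \<ge> 0\<close> by simp
    qed
  qed (use assms in simp)
qed

lemma
  fixes f :: "'a::euclidean_space \<Rightarrow> real"
  assumes "continuous_on UNIV f"
  shows lborel_integral_translation: "(LINT x|lborel. f (x + c)) = (LINT x|lborel. f x)"
    and lborel_integrable_translation: "integrable lborel (\<lambda>x. f (x + c)) \<longleftrightarrow> integrable lborel f"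
proof -
  have f: "f \<in> borel_measurable borel"
    using assms by (rule borel_measurable_continuous_onI)
  have "integral\<^sup>L (distr lborel borel ((+) c)) f = (LINT x|lborel. f (c + x))"
    using f by (intro integral_distr) simp_all
  then show "(LINT x|lborel. f (x + c)) = (LINT x|lborel. f x)"
    by (simp add: lborel_distr_plus add.commute)
  have "integrable (distr lborel borel ((+) c)) f \<longleftrightarrow> integrable lborel (\<lambda>x. f (c + x))"
    using f by (intro integrable_distr_eq) simp_all
  then show "integrable lborel (\<lambda>x. f (x + c)) \<longleftrightarrow> integrable lborel f"
    by (simp add: lborel_distr_plus add.commute)
qed

text \<open>By translation invariance all difference quotients of \<open>\<phi>\<close> in direction
  \<open>b\<close> have integral 0, and dominated convergence passes to the derivative. Off
  \<open>S\<close> the function vanishes on an open set, hence so does its derivative.\<close>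

lemma integral_partial_derivative_eq_0:
  fixes \<phi> :: "'a::euclidean_space \<Rightarrow> real"
  assumes diff: "\<And>x. \<phi> differentiable at x"
    and g: "continuous_on UNIV (\<lambda>x. frechet_derivative \<phi> (at x) b)"
    and S: "compact S" "\<And>x. x \<notin> S \<Longrightarrow> \<phi> x = 0"
  shows "(LINT x|lborel. frechet_derivative \<phi> (at x) b) = 0"
    and "\<And>x. x \<notin> S \<Longrightarrow> frechet_derivative \<phi> (at x) b = 0"
proof -
  define g where "g x = frechet_derivative \<phi> (at x) b" for x
  have d\<phi>: "(\<phi> has_derivative frechet_derivative \<phi> (at x)) (at x)" for x
    using diff frechet_derivative_works by blast
  have \<phi>c: "continuous_on UNIV \<phi>"
    using diff differentiable_imp_continuous_within by (simp add: continuous_on_eq_continuous_within) blast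
  have g0: "g x = 0" if "x \<notin> S" for x
  proof -
    have "((\<lambda>_. 0) has_derivative (\<lambda>_. 0)) (at x)" by simp
    then have "(\<phi> has_derivative (\<lambda>_. 0)) (at x)"
      using S compact_imp_closed[OF S(1)] that
      by (intro has_derivative_transform_within_open[of "\<lambda>_. 0" "\<lambda>_. 0" x UNIV "- S" \<phi>]) auto
    then show ?thesis
      unfolding g_def using frechet_derivative_at[of \<phi> "\<lambda>_. 0" x] by metis
  qed
  then show "\<And>x. x \<notin> S \<Longrightarrow> frechet_derivative \<phi> (at x) b = 0" by (simp add: g_def)
  obtain M where M: "M > 0" "\<And>x. x \<in> S \<Longrightarrow> \<bar>g x\<bar> \<le> M"
  proof -
    have "bounded (g ` S)"
      using g S(1) unfolding g_def
      by (intro compact_imp_bounded compact_continuous_image) (auto elim: continuous_on_subset)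
    then show ?thesis using that unfolding bounded_pos by auto
  qed
  have gM: "\<bar>g x\<bar> \<le> M" for x
    using M g0 by (cases "x \<in> S") auto
  obtain \<rho> where \<rho>: "\<And>x. x \<in> S \<Longrightarrow> norm x \<le> \<rho>"
    using compact_imp_bounded[OF S(1)] unfolding bounded_iff by blast
  have line: "((\<lambda>t. \<phi> (x + t *\<^sub>R b)) has_real_derivative g (x + t *\<^sub>R b)) (at t)" for x t
  proof -
    have "((\<lambda>t. x + t *\<^sub>R b) has_derivative (\<lambda>h. h *\<^sub>R b)) (at t)"
      by (auto intro!: derivative_eq_intros)
    from diff_chain_at[OF this d\<phi>]
    have "((\<lambda>t. \<phi> (x + t *\<^sub>R b)) has_derivative
        (\<lambda>h. frechet_derivative \<phi> (at (x + t *\<^sub>R b)) (h *\<^sub>R b))) (at t)"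
      by (simp add: comp_def)
    moreover have "frechet_derivative \<phi> (at (x + t *\<^sub>R b)) (h *\<^sub>R b) = g (x + t *\<^sub>R b) * h" for h
      using linear_scale[OF has_derivative_linear[OF d\<phi>]] by (simp add: g_def)
    ultimately show ?thesis by (simp add: has_field_derivative_def)
  qed
  \<comment> \<open>Steps of size at most 1 keep the supports of all quotients in the ball of radius
    \<open>\<rho> + norm b\<close>, which carries the dominating function.\<close>
  define h :: "nat \<Rightarrow> real" where "h k = 1 / Suc k" for k
  have h: "0 < h k" "h k \<le> 1" for k by (auto simp: h_def)
  define \<psi> where "\<psi> k x = (\<phi> (x + h k *\<^sub>R b) - \<phi> x) / h k" for k x
  have int: "integrable lborel \<phi>"
  proof -
    have "(\<lambda>x. indicator S x *\<^sub>R \<phi> x) = \<phi>" using S(2) by (intro ext) (auto simp: indicator_def)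
    then show ?thesis
      using borel_integrable_compact[OF S(1) continuous_on_subset[OF \<phi>c]] by simp
  qed
  have int': "integrable lborel (\<lambda>x. \<phi> (x + c))" for c
    using lborel_integrable_translation[OF \<phi>c] int by simp
  have "(\<lambda>k. LINT x|lborel. \<psi> k x) \<longlonglongrightarrow> (LINT x|lborel. g x)"
  proof (rule integral_dominated_convergence)
    show "g \<in> borel_measurable lborel"
      using borel_measurable_continuous_onI[OF g] by (simp add: g_def[abs_def])
    show "\<psi> k \<in> borel_measurable lborel" for k
      using borel_measurable_integrable[OF int] borel_measurable_integrable[OF int'] unfolding \<psi>_def
      by measurable
    have "integrable lborel (\<lambda>x::'a. indicator (cball 0 (\<rho> + norm b)) x *\<^sub>R M)"
      by (intro borel_integrable_compact) auto
    then show "integrable lborel (\<lambda>x::'a. indicator (cball 0 (\<rho> + norm b)) x * M)" by simp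
    show "AE x in lborel. (\<lambda>k. \<psi> k x) \<longlonglongrightarrow> g x"
    proof (rule AE_I2)
      fix x
      have "((\<lambda>t. (\<phi> (x + t *\<^sub>R b) - \<phi> x) / t) \<longlongrightarrow> g x) (at 0)"
        using line[of x 0] by (simp add: DERIV_def)
      moreover have "filterlim h (at 0) sequentially"
        unfolding filterlim_at
      proof
        show "h \<longlonglongrightarrow> 0" unfolding h_def using LIMSEQ_inverse_real_of_nat by (simp add: inverse_eq_divide)
        show "\<forall>\<^sub>F k in sequentially. h k \<in> UNIV \<and> h k \<noteq> 0"
          by (simp add: h_def)
      qed
      ultimately show "(\<lambda>k. \<psi> k x) \<longlonglongrightarrow> g x"
        unfolding \<psi>_def by (rule filterlim_compose)
    qed
    show "AE x in lborel. norm (\<psi> k x) \<le> indicator (cball 0 (\<rho> + norm b)) x * M" for k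
    proof (rule AE_I2)
      fix x
      show "norm (\<psi> k x) \<le> indicator (cball 0 (\<rho> + norm b)) x * M"
      proof (cases "x \<in> cball 0 (\<rho> + norm b)")
        case True
        obtain z where "\<phi> (x + h k *\<^sub>R b) - \<phi> (x + 0 *\<^sub>R b) = (h k - 0) * g (x + z *\<^sub>R b)"
          using MVT2[OF h(1)[of k], of "\<lambda>t. \<phi> (x + t *\<^sub>R b)" "\<lambda>t. g (x + t *\<^sub>R b)"] line by blast
        then have "\<psi> k x = g (x + z *\<^sub>R b)"
          using h(1)[of k] by (simp add: \<psi>_def)
        then show ?thesis using gM True by simp
      next
        case False
        then have x: "norm x > \<rho> + norm b" by simp
        have "x \<notin> S" using \<rho>[of x] x norm_ge_zero[of b] by force
        moreover have "x + h k *\<^sub>R b \<notin> S"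
        proof
          assume "x + h k *\<^sub>R b \<in> S"
          then have "norm (x + h k *\<^sub>R b) \<le> \<rho>" by (rule \<rho>)
          moreover have "norm (h k *\<^sub>R b) \<le> norm b"
            using h[of k] by (simp add: mult_left_le_one_le)
          ultimately show False
            using x norm_triangle_ineq4[of "x + h k *\<^sub>R b" "h k *\<^sub>R b"] by simp
        qed
        ultimately show ?thesis using S(2) False by (simp add: \<psi>_def)
      qed
    qed
  qed
  moreover have "(LINT x|lborel. \<psi> k x) = 0" for k
    unfolding \<psi>_def using int int' lborel_integral_translation[OF \<phi>c] by simp
  ultimately have "(LINT x|lborel. g x) = 0"
    by (simp add: LIMSEQ_const_iff)
  then show "(LINT x|lborel. frechet_derivative \<phi> (at x) b) = 0" by (simp add: g_def)
qed

lemma L2_linear: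
  assumes "u \<in> L2 \<Omega>" "v \<in> L2 \<Omega>"
  shows "(\<lambda>x. a * u x + b * v x) \<in> L2 \<Omega>"
proof -
  have [measurable]: "u \<in> borel_measurable (lebesgue_on \<Omega>)" "v \<in> borel_measurable (lebesgue_on \<Omega>)"
    and int: "integrable (lebesgue_on \<Omega>) (\<lambda>x. (u x)\<^sup>2)" "integrable (lebesgue_on \<Omega>) (\<lambda>x. (v x)\<^sup>2)"
    using assms by (auto simp: L2_def)
  have "integrable (lebesgue_on \<Omega>) (\<lambda>x. (a * u x + b * v x)\<^sup>2)"
  proof (rule Bochner_Integration.integrable_bound)
    show "integrable (lebesgue_on \<Omega>) (\<lambda>x. 2 * a\<^sup>2 * (u x)\<^sup>2 + 2 * b\<^sup>2 * (v x)\<^sup>2)"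
      using int by simp
    have "(a * u x + b * v x)\<^sup>2 \<le> 2 * a\<^sup>2 * (u x)\<^sup>2 + 2 * b\<^sup>2 * (v x)\<^sup>2" for x
      using zero_le_power2[of "a * u x - b * v x"] by (simp add: power2_eq_square algebra_simps)
    then show "AE x in lebesgue_on \<Omega>. norm ((a * u x + b * v x)\<^sup>2)
        \<le> norm (2 * a\<^sup>2 * (u x)\<^sup>2 + 2 * b\<^sup>2 * (v x)\<^sup>2)"
      by (intro AE_I2) (simp add: abs_le_iff order_trans)
  qed measurable
  then show ?thesis by (simp add: L2_def)
qed

lemma L2_const: "\<Omega> \<in> lmeasurable \<Longrightarrow> (\<lambda>_. c) \<in> L2 \<Omega>"
  by (simp add: L2_def finite_measure.integrable_const finite_measure_lebesgue_on)

text \<open>That the constant 1 has weak gradient 0 means that partial derivatives of test functions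
  integrate to 0 over \<open>\<Omega>\<close>. With zero gradient, both sides of the form identity
  vanish.\<close>

lemma neumann_laplacian_const:
  fixes \<Omega> :: "'a::euclidean_space set"
  assumes "open \<Omega>" "bounded \<Omega>"
  shows "neumann_laplacian \<Omega> (\<lambda>_. 1) (\<lambda>_. 0)"
proof -
  have \<Omega>: "\<Omega> \<in> lmeasurable" using assms by (simp add: lmeasurable_open)
  have zero: "(LINT x|lebesgue_on \<Omega>. frechet_derivative \<phi> (at x) b) = 0"
    if \<phi>: "test_function \<Omega> \<phi>" and b: "b \<in> Basis" for \<phi> :: "'a \<Rightarrow> real" and b
  proof -
    define S where "S = closure {x. \<phi> x \<noteq> 0}"
    have S: "compact S" "S \<subseteq> \<Omega>" using \<phi> by (auto simp: test_function_def S_def)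
    have out: "\<phi> x = 0" if "x \<notin> S" for x
      using that closure_subset[of "{x. \<phi> x \<noteq> 0}"] by (auto simp: S_def)
    have "class_C (Suc 0) \<phi>" using \<phi> unfolding test_function_def by blast
    then have diff: "\<And>x. \<phi> differentiable at x"
      and cont: "continuous_on UNIV (\<lambda>x. frechet_derivative \<phi> (at x) b)"
      using b by auto
    note deriv = integral_partial_derivative_eq_0[OF diff cont S(1) out]
    have "(LINT x|lebesgue_on \<Omega>. frechet_derivative \<phi> (at x) b)
        = (LINT x|lebesgue. indicator \<Omega> x *\<^sub>R frechet_derivative \<phi> (at x) b)"
      using \<Omega> by (intro integral_restrict_space) (auto simp: fmeasurable_def)
    also have "(\<lambda>x. indicator \<Omega> x *\<^sub>R frechet_derivative \<phi> (at x) b) = (\<lambda>x. frechet_derivative \<phi> (at x) b)"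
      using deriv(2) S(2) by (fastforce simp: indicator_def)
    also have "(LINT x|lebesgue. frechet_derivative \<phi> (at x) b) = (LINT x|lborel. frechet_derivative \<phi> (at x) b)"
      using borel_measurable_continuous_onI[OF cont] by (intro integral_completion) simp
    also have "\<dots> = 0" by (rule deriv(1))
    finally show ?thesis .
  qed
  have "H1_gradient \<Omega> (\<lambda>_. 1) (\<lambda>_. 0)"
    unfolding H1_gradient_def using zero L2_const[OF \<Omega>] by simp
  then show ?thesis
    unfolding neumann_laplacian_def using L2_const[OF \<Omega>, of 0]
    by (intro conjI exI[of _ "\<lambda>_. 0"]) simp_all
qed

text \<open>Integrate the pointwise inequality \<open>\<bar>w\<bar> \<le> (a + w^2 / a) / 2\<close>
  over a set of finite measure. A positive bound \<open>a\<close> in place of the norm also covers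
  the case of norm 0.\<close>

lemma L1_le_L2:
  assumes \<Omega>: "\<Omega> \<in> lmeasurable" and w: "w \<in> L2 \<Omega>" and a: "L2_norm_on \<Omega> w \<le> a" "a > 0"
  shows "(LINT x|lebesgue_on \<Omega>. \<bar>w x\<bar>) \<le> (measure lebesgue \<Omega> + 1) / 2 * a"
proof -
  interpret finite_measure "lebesgue_on \<Omega>" using \<Omega> by (rule finite_measure_lebesgue_on)
  have [measurable]: "w \<in> borel_measurable (lebesgue_on \<Omega>)"
    and int: "integrable (lebesgue_on \<Omega>) (\<lambda>x. (w x)\<^sup>2)"
    using w by (auto simp: L2_def)
  have amgm: "\<bar>w x\<bar> \<le> (a + (w x)\<^sup>2 / a) / 2" for x
    using zero_le_power2[of "\<bar>w x\<bar> - a"] a(2) by (simp add: field_simps power2_eq_square)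
  have int2: "integrable (lebesgue_on \<Omega>) (\<lambda>x. (a + (w x)\<^sup>2 / a) / 2)"
    using int by simp
  have "integrable (lebesgue_on \<Omega>) (\<lambda>x. \<bar>w x\<bar>)"
  proof (rule Bochner_Integration.integrable_bound[OF int2])
    show "AE x in lebesgue_on \<Omega>. norm \<bar>w x\<bar> \<le> norm ((a + (w x)\<^sup>2 / a) / 2)"
      using order_trans[OF amgm abs_ge_self] by (intro AE_I2) (simp only: real_norm_def abs_idempotent)
  qed measurable
  then have "(LINT x|lebesgue_on \<Omega>. \<bar>w x\<bar>) \<le> (LINT x|lebesgue_on \<Omega>. (a + (w x)\<^sup>2 / a) / 2)"
    using int2 amgm by (rule integral_mono)
  also have "\<dots> = (a * measure lebesgue \<Omega> + (LINT x|lebesgue_on \<Omega>. (w x)\<^sup>2) / a) / 2"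
    using int \<Omega> by (simp add: measure_restrict_space fmeasurable_def)
  also have "\<dots> \<le> (a * measure lebesgue \<Omega> + a) / 2"
  proof -
    have "(LINT x|lebesgue_on \<Omega>. (w x)\<^sup>2) \<le> a\<^sup>2"
      using a unfolding L2_norm_on_def by (simp add: real_le_rsqrt sqrt_le_D real_sqrt_le_iff real_le_lsqrt)
    then have "(LINT x|lebesgue_on \<Omega>. (w x)\<^sup>2) / a \<le> a"
      using a(2) by (simp add: pos_divide_le_eq power2_eq_square)
    then show ?thesis by (intro divide_right_mono add_left_mono) simp_all
  qed
  finally show ?thesis by (simp add: algebra_simps)
qed

lemma C0_semigroup_L2_linear:
  assumes "C0_semigroup_L2 \<Omega> T" "t \<ge> 0" "u \<in> L2 \<Omega>" "v \<in> L2 \<Omega>"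
  shows "AE x in lebesgue_on \<Omega>. T t (\<lambda>y. a * u y + b * v y) x = a * T t u x + b * T t v x"
  using assms unfolding C0_semigroup_L2_def by blast

text \<open>The part of \<open>\<Omega>\<close> where \<open>f\<close> differs from \<open>c\<close>
  is open and null, hence empty; continuity carries the value to the closure.\<close>

lemma AE_const_imp_const_on_closure:
  fixes f :: "'a::euclidean_space \<Rightarrow> real"
  assumes "open \<Omega>" and f: "continuous_on (closure \<Omega>) f"
    and ae: "AE x in lebesgue_on \<Omega>. f x = c" and "x \<in> closure \<Omega>"
  shows "f x = c"
proof (rule continuous_constant_on_closure[OF f _ \<open>x \<in> closure \<Omega>\<close>])
  fix y assume "y \<in> \<Omega>"
  define A where "A = \<Omega> \<inter> f -` (- {c})"
  have "open A"
    unfolding A_def using assms(1) continuous_on_subset[OF f closure_subset]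
    by (intro continuous_open_preimage) auto
  have "AE x in lebesgue. x \<in> \<Omega> \<longrightarrow> f x = c"
    using ae assms(1) by (subst (asm) AE_restrict_space_iff) (auto intro: borel_open)
  then have "A \<in> null_sets lebesgue"
    using \<open>open A\<close> by (intro AE_iff_null_sets[THEN iffD2]) (auto simp: A_def borel_open)
  then have "negligible A" by (simp add: negligible_iff_null_sets)
  then have "A = {}" using \<open>open A\<close> open_not_negligible by blast
  then show "f y = c" using \<open>y \<in> \<Omega>\<close> by (auto simp: A_def)
qed

text \<open>
  Only the restriction to \<open>C(closure \<Omega>)\<close> is known to be contractive, so \<open>T t\<close> enters through its
  own bound at the fixed time \<open>t\<close>, which suffices for the right derivative of \<open>t \<mapsto> S t 1\<close> in \<open>L\<^sup>1\<close>
  to vanish; continuity in \<open>t\<close> comes from \<open>S\<close>.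
\<close>

lemma neumann_semigroup_markov:
  fixes \<Omega> :: "'a::euclidean_space set"
  assumes "\<Omega> \<noteq> {}" "open \<Omega>" "bounded \<Omega>" and S: "neumann_semigroup_C \<Omega> d S"
  shows "markov_semigroup (closure \<Omega>) S"
proof
  let ?K = "closure \<Omega>" and ?M = "lebesgue_on \<Omega>"
  show "compact ?K" using \<open>bounded \<Omega>\<close> by simp
  then have "compact ?K" .
  show "?K \<noteq> {}" using \<open>\<Omega> \<noteq> {}\<close> by simp
  have SC: "contraction_semigroup_C ?K S" using S by (simp add: neumann_semigroup_C_def)
  then show "contraction_semigroup_C ?K S" .
  obtain T where T: "neumann_semigroup_L2 \<Omega> d T"
    and ST: "\<forall>t\<ge>0. \<forall>u. continuous_on ?K u \<longrightarrow> (AE x in ?M. S t u x = T t u x)"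
    using S unfolding neumann_semigroup_C_def by blast
  have \<Omega>: "\<Omega> \<in> lmeasurable" using assms by (simp add: lmeasurable_open)
  interpret finite_measure ?M using \<Omega> by (rule finite_measure_lebesgue_on)
  have sets_\<Omega>: "\<Omega> \<in> sets lebesgue" using \<Omega> by (simp add: fmeasurable_def)
  define e where "e t = S t (\<lambda>_. 1)" for t
  have ec: "continuous_on ?K (e t)" if "t \<ge> 0" for t
    unfolding e_def using contraction_semigroup_continuous[OF SC that] by simp
  have e_bound: "\<bar>e t x\<bar> \<le> 1" if "t \<ge> 0" "x \<in> ?K" for t x
    unfolding e_def using contraction_semigroup_bound[OF SC \<open>compact ?K\<close> that(1) _ _ that(2)] by simp
  have em [measurable]: "e t \<in> borel_measurable ?M" if "t \<ge> 0" for t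
    using continuous_on_subset[OF ec[OF that] closure_subset] sets_\<Omega>
    by (rule continuous_imp_measurable_on_sets_lebesgue)
  have int: "integrable ?M w" if "w \<in> borel_measurable ?M" "\<And>x. x \<in> \<Omega> \<Longrightarrow> \<bar>w x\<bar> \<le> B" for w :: "'a \<Rightarrow> real" and B
    using that by (intro integrable_const_bound[of _ B]) auto
  have eL2: "e t \<in> L2 \<Omega>" if "t \<ge> 0" for t
    unfolding L2_def using em[OF that] e_bound[OF that] closure_subset[of \<Omega>]
    by (auto intro!: int[of _ 1] borel_measurable_power simp: abs_square_le_1)
  have one: "(\<lambda>_. 1) \<in> L2 \<Omega>" by (rule L2_const[OF \<Omega>])
  have C0: "C0_semigroup_L2 \<Omega> T" using T by (simp add: neumann_semigroup_L2_def)
  have TL2: "T t u \<in> L2 \<Omega>" if "t \<ge> 0" "u \<in> L2 \<Omega>" for t u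
    using C0 that unfolding C0_semigroup_L2_def by blast
  have gen: "((\<lambda>t. L2_norm_on \<Omega> (\<lambda>x. (T t (\<lambda>_. 1) x - 1) / t - 0)) \<longlongrightarrow> 0) (at_right 0)"
  proof -
    have "\<exists>w. neumann_laplacian \<Omega> (\<lambda>_. 1) w \<and> (\<lambda>_. 0) \<in> L2 \<Omega> \<and> (AE x in ?M. 0 = d * w x)"
      using neumann_laplacian_const[OF assms(2,3)] L2_const[OF \<Omega>]
      by (intro exI[of _ "\<lambda>_. 0"]) simp
    then have "generator_L2 \<Omega> T (\<lambda>_. 1) (\<lambda>_. 0)"
      using T unfolding neumann_semigroup_L2_def by blast
    then show ?thesis unfolding generator_L2_def by blast
  qed
  define V where "V = (measure lebesgue \<Omega> + 1) / 2"
  have "V > 0" unfolding V_def by (simp add: add_nonneg_pos)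
  \<comment> \<open>Almost everywhere \<open>(e (t + h) - e t) / h\<close> is \<open>T t\<close>
    applied to \<open>(T h 1 - 1) / h\<close>, which tends to 0 in L2 as 1 is mapped to 0 by the
    generator. The bound of \<open>T t\<close> and \<open>L1_le_L2\<close> transfer this to
    L1.\<close>
  have step: "\<exists>\<delta>>0. \<forall>h. 0 < h \<and> h < \<delta> \<longrightarrow> (LINT x|?M. \<bar>e (t + h) x - e t x\<bar>) \<le> \<epsilon> * h"
    if "t \<ge> 0" "\<epsilon> > 0" for t \<epsilon>
  proof -
    have "\<exists>C. \<forall>u\<in>L2 \<Omega>. L2_norm_on \<Omega> (T t u) \<le> C * L2_norm_on \<Omega> u"
      using C0 \<open>t \<ge> 0\<close> unfolding C0_semigroup_L2_def by blast
    then obtain c where c: "\<And>u. u \<in> L2 \<Omega> \<Longrightarrow> L2_norm_on \<Omega> (T t u) \<le> c * L2_norm_on \<Omega> u" by blast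
    \<comment> \<open>The constant \<open>c\<close> comes without a sign; enlarging it makes it a
      safe divisor in \<open>\<eta>\<close>, which is chosen so that
      \<open>V * (C * \<eta>) = \<epsilon>\<close>.\<close>
    define C where "C = max c 1"
    have "C > 0" by (simp add: C_def)
    have C: "L2_norm_on \<Omega> (T t u) \<le> C * L2_norm_on \<Omega> u" if "u \<in> L2 \<Omega>" for u
    proof -
      have "L2_norm_on \<Omega> u \<ge> 0" by (simp add: L2_norm_on_def)
      then have "c * L2_norm_on \<Omega> u \<le> C * L2_norm_on \<Omega> u"
        by (intro mult_right_mono) (simp add: C_def)
      then show ?thesis using c[OF that] by linarith
    qed
    define \<eta> where "\<eta> = \<epsilon> / (V * C)"
    have "\<eta> > 0" using \<open>V > 0\<close> \<open>C > 0\<close> \<open>\<epsilon> > 0\<close> by (simp add: \<eta>_def)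
    obtain \<delta> where \<delta>: "\<delta> > 0"
      "\<And>h. 0 < h \<Longrightarrow> h < \<delta> \<Longrightarrow> L2_norm_on \<Omega> (\<lambda>x. (T h (\<lambda>_. 1) x - 1) / h - 0) < \<eta>"
      using order_tendstoD(2)[OF gen \<open>\<eta> > 0\<close>] unfolding eventually_at_right_field by blast
    show ?thesis
    proof (intro exI[of _ \<delta>] conjI allI impI \<open>\<delta> > 0\<close>)
      fix h assume h: "0 < h \<and> h < \<delta>"
      define z where "z x = (1 / h) * T h (\<lambda>_. 1) x + (- 1 / h) * 1" for x
      have z_eq: "z = (\<lambda>x. (T h (\<lambda>_. 1) x - 1) / h - 0)"
        by (rule ext) (simp add: z_def diff_divide_distrib)
      have Th: "T h (\<lambda>_. 1) \<in> L2 \<Omega>" using h by (intro TL2 one) simp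
      have z: "z \<in> L2 \<Omega>" unfolding z_def by (rule L2_linear[OF Th one])
      have lin: "AE x in ?M. T t z x = (1 / h) * T t (T h (\<lambda>_. 1)) x + (- 1 / h) * T t (\<lambda>_. 1) x"
        using C0_semigroup_L2_linear[OF C0 \<open>t \<ge> 0\<close> Th one] unfolding z_def .
      have add: "AE x in ?M. T (t + h) (\<lambda>_. 1) x = T t (T h (\<lambda>_. 1)) x"
        using C0 \<open>t \<ge> 0\<close> h one unfolding C0_semigroup_L2_def by force
      have e1: "AE x in ?M. e (t + h) x = T (t + h) (\<lambda>_. 1) x"
        unfolding e_def using ST \<open>t \<ge> 0\<close> h by simp
      have e2: "AE x in ?M. e t x = T t (\<lambda>_. 1) x"
        unfolding e_def using ST \<open>t \<ge> 0\<close> by simp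
      have ae: "AE x in ?M. T t z x = (e (t + h) x - e t x) / h"
        using lin add e1 e2 by eventually_elim (simp add: diff_divide_distrib)
      have Tz: "T t z \<in> L2 \<Omega>" using TL2 \<open>t \<ge> 0\<close> z by blast
      have "L2_norm_on \<Omega> z \<le> \<eta>" using \<delta>(2)[of h] h unfolding z_eq by simp
      then have "C * L2_norm_on \<Omega> z \<le> C * \<eta>" using \<open>C > 0\<close> by (intro mult_left_mono) auto
      then have "L2_norm_on \<Omega> (T t z) \<le> C * \<eta>" using C[OF z] by linarith
      then have "(LINT x|?M. \<bar>T t z x\<bar>) \<le> V * (C * \<eta>)"
        unfolding V_def using \<open>C > 0\<close> \<open>\<eta> > 0\<close> by (intro L1_le_L2[OF \<Omega> Tz]) simp_all
      also have "V * (C * \<eta>) = \<epsilon>" using \<open>V > 0\<close> \<open>C > 0\<close> by (simp add: \<eta>_def)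
      also have "(LINT x|?M. \<bar>T t z x\<bar>) = (LINT x|?M. \<bar>e (t + h) x - e t x\<bar> / h)"
      proof (rule integral_cong_AE)
        show "(\<lambda>x. \<bar>T t z x\<bar>) \<in> borel_measurable ?M"
          using Tz by (intro borel_measurable_abs) (simp add: L2_def)
        show "(\<lambda>x. \<bar>e (t + h) x - e t x\<bar> / h) \<in> borel_measurable ?M"
          using em[of t] em[of "t + h"] \<open>t \<ge> 0\<close> h by simp
        show "AE x in ?M. \<bar>T t z x\<bar> = \<bar>e (t + h) x - e t x\<bar> / h"
          using ae h by (auto elim!: eventually_mono simp: abs_divide)
      qed
      finally show "(LINT x|?M. \<bar>e (t + h) x - e t x\<bar>) \<le> \<epsilon> * h"
        using h by (simp add: pos_divide_le_eq)
    qed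
  qed
  have diff_int: "integrable ?M (\<lambda>x. \<bar>e t x - e s x\<bar>)" if "t \<ge> 0" "s \<ge> 0" for t s
  proof (rule int[of _ 2])
    show "(\<lambda>x. \<bar>e t x - e s x\<bar>) \<in> borel_measurable ?M" using em that by simp
    show "\<bar>\<bar>e t x - e s x\<bar>\<bar> \<le> 2" if "x \<in> \<Omega>" for x
    proof -
      have "x \<in> ?K" using that closure_subset by blast
      then show ?thesis using e_bound[OF \<open>t \<ge> 0\<close>, of x] e_bound[OF \<open>s \<ge> 0\<close>, of x] by simp
    qed
  qed
  have e0: "e 0 x = 1" if "x \<in> ?K" for x
    unfolding e_def using contraction_semigroup_zero[OF SC _ that] by simp
  \<comment> \<open>A scalar measure of how far \<open>e t\<close> is from 1. By the triangle
    inequality its increments are at most those estimated in \<open>step\<close>.\<close>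
  define \<phi> where "\<phi> t = (LINT x|?M. \<bar>e t x - e 0 x\<bar>)" for t
  have \<phi>_diff: "\<phi> t \<le> \<phi> s + (LINT x|?M. \<bar>e t x - e s x\<bar>)" if "t \<ge> 0" "s \<ge> 0" for t s
  proof -
    have "\<phi> t \<le> (LINT x|?M. \<bar>e s x - e 0 x\<bar> + \<bar>e t x - e s x\<bar>)"
      unfolding \<phi>_def using that by (intro integral_mono diff_int Bochner_Integration.integrable_add) auto
    then show ?thesis
      unfolding \<phi>_def using that by (simp add: diff_int)
  qed
  have \<phi>_cont: "continuous_on {0..\<tau>} \<phi>" for \<tau>
    unfolding continuous_on_iff
  proof (intro ballI allI impI)
    fix t and \<epsilon> :: real assume t: "t \<in> {0..\<tau>}" and "\<epsilon> > 0"
    \<comment> \<open>The measure of \<open>\<Omega>\<close> is at most \<open>2 * V\<close>, so a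
      uniform bound \<open>\<eta>\<close> integrates to at most
      \<open>\<epsilon> / 2\<close>.\<close>
    define \<eta> where "\<eta> = \<epsilon> / (4 * V)"
    have "\<eta> > 0" using \<open>\<epsilon> > 0\<close> \<open>V > 0\<close> by (simp add: \<eta>_def)
    have "\<forall>\<^sub>F h in at_right 0. \<forall>y\<in>?K. dist (S h (\<lambda>_. 1) y) 1 < \<eta>"
      using uniform_limitD[OF contraction_semigroup_right_limit[OF SC] \<open>\<eta> > 0\<close>, of "\<lambda>_. 1"] by simp
    then obtain \<delta> where \<delta>: "\<delta> > 0" "\<And>h y. 0 < h \<Longrightarrow> h < \<delta> \<Longrightarrow> y \<in> ?K \<Longrightarrow> dist (S h (\<lambda>_. 1) y) 1 < \<eta>"
      unfolding eventually_at_right_field by blast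
    have bound: "(LINT x|?M. \<bar>e a x - e b x\<bar>) < \<epsilon>" if ab: "a \<ge> 0" "b \<ge> 0" "\<bar>a - b\<bar> < \<delta>" for a b
    proof -
      have le: "\<bar>e a x - e b x\<bar> \<le> \<eta>" if "x \<in> ?K" for x
        unfolding e_def
      proof (rule contraction_semigroup_time_diff[OF SC \<open>compact ?K\<close> ab(1,2) _ _ that])
        show "\<bar>S \<bar>a - b\<bar> (\<lambda>_. 1) y - 1\<bar> \<le> \<eta>" if "y \<in> ?K" for y
          using \<delta>(2)[of "\<bar>a - b\<bar>" y] ab(3) that e0[OF that] \<open>\<eta> > 0\<close>
          by (cases "a = b") (auto simp: e_def dist_real_def)
      qed simp
      have "(LINT x|?M. \<bar>e a x - e b x\<bar>) \<le> (LINT x|?M. \<eta>)"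
        using ab le closure_subset[of \<Omega>] by (intro integral_mono diff_int) auto
      also have "\<dots> = measure lebesgue \<Omega> * \<eta>"
        using sets_\<Omega> by (simp add: measure_restrict_space)
      also have "\<dots> \<le> 2 * V * \<eta>"
        using \<open>\<eta> > 0\<close> by (intro mult_right_mono) (simp_all add: V_def)
      also have "\<dots> = \<epsilon> / 2" using \<open>V > 0\<close> by (simp add: \<eta>_def)
      also have "\<dots> < \<epsilon>" using \<open>\<epsilon> > 0\<close> by simp
      finally show ?thesis .
    qed
    show "\<exists>\<delta>>0. \<forall>s\<in>{0..\<tau>}. dist s t < \<delta> \<longrightarrow> dist (\<phi> s) (\<phi> t) < \<epsilon>"
    proof (intro exI[of _ \<delta>] conjI \<open>\<delta> > 0\<close> ballI impI)
      fix s assume "s \<in> {0..\<tau>}" "dist s t < \<delta>"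
      then have "s \<ge> 0" "t \<ge> 0" "\<bar>s - t\<bar> < \<delta>" "\<bar>t - s\<bar> < \<delta>"
        using t by (auto simp: dist_real_def)
      then show "dist (\<phi> s) (\<phi> t) < \<epsilon>"
        using \<phi>_diff[of s t] \<phi>_diff[of t s] bound[of s t] bound[of t s]
        unfolding dist_real_def by linarith
    qed
  qed
  fix t :: real and x assume "t \<ge> 0" "x \<in> ?K"
  have "\<phi> t \<le> 0"
  proof (rule nonpos_of_right_derivative_nonpos[OF \<phi>_cont \<open>t \<ge> 0\<close>])
    show "\<phi> 0 \<le> 0" by (simp add: \<phi>_def)
    fix s \<epsilon> :: real assume "s \<ge> 0" "\<epsilon> > 0"
    from step[OF this] obtain \<delta> where \<delta>: "\<delta> > 0"
      "\<And>h. 0 < h \<Longrightarrow> h < \<delta> \<Longrightarrow> (LINT x|?M. \<bar>e (s + h) x - e s x\<bar>) \<le> \<epsilon> * h" by blast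
    have "\<phi> (s + h) \<le> \<phi> s + \<epsilon> * h" if "0 < h" "h < \<delta>" for h
      using \<phi>_diff[of "s + h" s] \<delta>(2)[OF that] \<open>s \<ge> 0\<close> that by linarith
    then show "\<exists>\<delta>>0. \<forall>h. 0 < h \<and> h < \<delta> \<longrightarrow> \<phi> (s + h) \<le> \<phi> s + \<epsilon> * h"
      using \<open>\<delta> > 0\<close> by blast
  qed
  moreover have "\<phi> t \<ge> 0" unfolding \<phi>_def by (rule integral_nonneg_AE) simp
  ultimately have "(LINT x|?M. \<bar>e t x - e 0 x\<bar>) = 0" unfolding \<phi>_def by (rule antisym)
  then have "AE x in ?M. \<bar>e t x - e 0 x\<bar> = 0"
    using integral_nonneg_eq_0_iff_AE[OF diff_int[OF \<open>t \<ge> 0\<close> order_refl]] by simp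
  moreover have "AE x in ?M. x \<in> \<Omega>" by (rule AE_I2) simp
  ultimately have "AE x in ?M. e t x = 1"
  proof eventually_elim
    case (elim x)
    then show ?case using e0[of x] closure_subset[of \<Omega>] by auto
  qed
  then show "S t (\<lambda>_. 1) x = 1"
    using AE_const_imp_const_on_closure[OF \<open>open \<Omega>\<close> ec[OF \<open>t \<ge> 0\<close>] _ \<open>x \<in> ?K\<close>] by (simp add: e_def)
qed

theorem theorem6p4:
  fixes F :: "real^'n \<Rightarrow> real^'n" and \<alpha> \<beta> :: "real^'n"
  assumes "locally_lipschitz F"
    and "\<forall>j. \<alpha> $ j < \<beta> $ j"
  shows "(invariant_under (=) (ode_solution F) {u. \<forall>j. u $ j \<in> {\<alpha> $ j..\<beta> $ j}}
            \<longleftrightarrow> R_inf F \<alpha> \<beta> \<and> R_sup F \<alpha> \<beta>)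
       \<and> (\<forall>(\<Omega> :: 'a::euclidean_space set) (d :: real^'n)
            (S :: 'n \<Rightarrow> real \<Rightarrow> ('a \<Rightarrow> real) \<Rightarrow> 'a \<Rightarrow> real).
            \<Omega> \<noteq> {} \<and> open \<Omega> \<and> connected \<Omega> \<and> bounded \<Omega> \<and> C1_boundary \<Omega> \<and>
            (\<forall>i. d $ i > 0) \<and> (\<forall>i. neumann_semigroup_C \<Omega> (d $ i) (S i)) \<longrightarrow>
            (invariant_under (equal_on (closure \<Omega>)) (mild_solution (closure \<Omega>) S F)
               {U. continuous_on (closure \<Omega>) U \<and>
                   (\<forall>x\<in>closure \<Omega>. \<forall>j. U x $ j \<in> {\<alpha> $ j..\<beta> $ j})}
             \<longleftrightarrow> R_inf F \<alpha> \<beta> \<and> R_sup F \<alpha> \<beta>))"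
proof (intro conjI allI impI)
  have le: "\<alpha> $ j \<le> \<beta> $ j" for j
    using assms(2) less_imp_le by blast
  show "invariant_under (=) (ode_solution F) {u. \<forall>j. u $ j \<in> {\<alpha> $ j..\<beta> $ j}}
      \<longleftrightarrow> R_inf F \<alpha> \<beta> \<and> R_sup F \<alpha> \<beta>"
    unfolding invariant_point_iff[OF locally_lipschitz_continuous[OF assms(1)]]
    using markov_semigroup_point assms(1) le by (rule box_invariant_iff)
  fix \<Omega> :: "'a set" and d :: "real^'n" and S :: "'n \<Rightarrow> real \<Rightarrow> ('a \<Rightarrow> real) \<Rightarrow> 'a \<Rightarrow> real"
  assume \<Omega>: "\<Omega> \<noteq> {} \<and> open \<Omega> \<and> connected \<Omega> \<and> bounded \<Omega> \<and> C1_boundary \<Omega> \<and>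
      (\<forall>i. d $ i > 0) \<and> (\<forall>i. neumann_semigroup_C \<Omega> (d $ i) (S i))"
  then have "markov_semigroup (closure \<Omega>) (S i)" for i
    by (intro neumann_semigroup_markov[of \<Omega> "d $ i"]) auto
  then show "invariant_under (equal_on (closure \<Omega>)) (mild_solution (closure \<Omega>) S F)
      (box_states (closure \<Omega>) \<alpha> \<beta>) \<longleftrightarrow> R_inf F \<alpha> \<beta> \<and> R_sup F \<alpha> \<beta>"
    using assms(1) le by (rule box_invariant_iff)
qed

end
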